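(* For $|\varepsilon|>0$ sufficiently small, the averaging method of first order predicts at most $5$ crossing limit cycles for the piecewise quadratic vector field $Z_{3,\varepsilon}$, a piecewise quadratic perturbation of the isochronous center $\dot x=-y-\tfrac43x^2,\ \dot y=x-\tfrac{16}{3}xy$, when the curve of discontinuity is the straight line $\{x=0\}$; moreover, this number is reached. That is: for every choice of the perturbation polynomials of degree at most $2$, the first averaged function $\mathcal{F}_1:(0,1/8)\to\mathbb{R}$ of $Z_{3,\varepsilon}$ has at most $5$ simple zeros in $(0,1/8)$, and there is a choice of the perturbation polynomials for which $\mathcal{F}_1$ has exactly $5$ simple zeros in $(0,1/8)$.
   Context: $Z_{3,\varepsilon}$ is the piecewise vector field equal to $(-y-\tfrac43x^2,\;x-\tfrac{16}{3}xy)+\varepsilon(P_1^{\pm},Q_1^{\pm})+\varepsilon^2(P_2^{\pm},Q_2^{\pm})$ on the two open half-planes (labelled $+$ and $-$) bounded by $\{x=0\}$, where $P_k^\pm,Q_k^\pm$ ($k=1,2$) are arbitrary real polynomials in $(x,y)$ of degree at most $2$. First averaged function. The birational change of variables $u=\frac{3x}{32x^2-24y+9}$, $v=\frac{-4x^2+3y}{32x^2-24y+9}$, with inverse $x=\frac{3u}{8v+1}$, $y=\frac{3(4u^2+8v^2+v)}{(8v+1)^2}$, transforms the unperturbed center into the linear center $\dot u=-v,\ \dot v=u$ and the line $\{x=0\}$ into $\{u=0\}$. Writing $u=r\sin\theta$, $v=-r\cos\theta$ and taking $\theta$ as independent variable, $Z_{3,\varepsilon}$ becomes $\frac{dr}{d\theta}=\varepsilon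 F_1(\theta,r)+O(\varepsilon^2)$ for $r\in(0,1/8)$, where $F_1$ is $2\pi$-periodic in $\theta$ and given by one analytic expression for $\theta\in(0,\pi)$ and another for $\theta\in(-\pi,0)$. The first averaged function is $\mathcal{F}_1(r)=\int_{-\pi}^{\pi}F_1(\theta,r)\,d\theta$, $r\in(0,1/8)$. A simple zero is $\rho$ with $\mathcal{F}_1(\rho)=0$ and $\mathcal{F}_1'(\rho)\ne0$. Each simple zero $\rho$ gives, for $|\varepsilon|>0$ small, a $2\pi$-periodic solution $r(\theta,\varepsilon)$ with $r(0,\varepsilon)\to\rho$ as $\varepsilon\to0$ (a crossing limit cycle); the number of limit cycles predicted by the averaging method of first order is the number of simple zeros of $\mathcal{F}_1$. *)

theory Defs
  imports "HOL-Analysis.Analysis"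
begin

type_synonym plane_field = "real \<times> real \<Rightarrow> real \<times> real"

definition poly2_deg_le :: "nat \<Rightarrow> (real \<times> real \<Rightarrow> real) \<Rightarrow> bool" where
  "poly2_deg_le d p \<longleftrightarrow>
     (\<exists>c. \<forall>x y. p (x, y) = (\<Sum>i\<le>d. \<Sum>j\<le>d - i. c i j * x ^ i * y ^ j))"

definition quadratic_field :: "plane_field \<Rightarrow> bool" where
  "quadratic_field X \<longleftrightarrow> poly2_deg_le 2 (\<lambda>p. fst (X p)) \<and> poly2_deg_le 2 (\<lambda>p. snd (X p))"

definition center3 :: plane_field where
  "center3 = (\<lambda>(x, y). (- y - 4/3 * x^2, x - 16/3 * x * y))"

(* X1p = (P1+, Q1+), X2p = (P2+, Q2+) live on x > 0, and X1m, X2m on x < 0.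
   The value on the line x = 0, where the piecewise field is not specified, is an
   arbitrary choice: it only affects the integrand F1 below at theta in {-pi, 0, pi}. *)
definition Z3 :: "plane_field \<Rightarrow> plane_field \<Rightarrow> plane_field \<Rightarrow> plane_field \<Rightarrow> real \<Rightarrow> plane_field" where
  "Z3 X1p X2p X1m X2m \<epsilon> p =
     (if fst p > 0
      then center3 p + \<epsilon> *\<^sub>R X1p p + \<epsilon>^2 *\<^sub>R X2p p
      else center3 p + \<epsilon> *\<^sub>R X1m p + \<epsilon>^2 *\<^sub>R X2m p)"

definition to_uv :: "real \<times> real \<Rightarrow> real \<times> real" where
  "to_uv = (\<lambda>(x, y). (3 * x / (32 * x^2 - 24 * y + 9),
                      (- 4 * x^2 + 3 * y) / (32 * x^2 - 24 * y + 9)))"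

definition from_uv :: "real \<times> real \<Rightarrow> real \<times> real" where
  "from_uv = (\<lambda>(u, v). (3 * u / (8 * v + 1),
                        3 * (4 * u^2 + 8 * v^2 + v) / (8 * v + 1)^2))"

definition uv_field :: "plane_field \<Rightarrow> plane_field" where
  "uv_field Z w = frechet_derivative to_uv (at (from_uv w)) (Z (from_uv w))"

(* u = r sin theta, v = - r cos theta, hence
   u' = r' sin theta + r theta' cos theta and v' = - r' cos theta + r theta' sin theta;
   solving for (r', theta') gives the two speeds. *)
definition polar_point :: "real \<Rightarrow> real \<Rightarrow> real \<times> real" where
  "polar_point \<theta> r = (r * sin \<theta>, - r * cos \<theta>)"

definition radial_speed :: "plane_field \<Rightarrow> real \<Rightarrow> real \<Rightarrow> real" where
  "radial_speed W \<theta> r =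
     fst (W (polar_point \<theta> r)) * sin \<theta> - snd (W (polar_point \<theta> r)) * cos \<theta>"

definition angular_speed :: "plane_field \<Rightarrow> real \<Rightarrow> real \<Rightarrow> real" where
  "angular_speed W \<theta> r =
     (fst (W (polar_point \<theta> r)) * cos \<theta> + snd (W (polar_point \<theta> r)) * sin \<theta>) / r"

definition dr_dtheta :: "plane_field \<Rightarrow> real \<Rightarrow> real \<Rightarrow> real" where
  "dr_dtheta Z \<theta> r = radial_speed (uv_field Z) \<theta> r / angular_speed (uv_field Z) \<theta> r"

(* The coefficient F1 in dr/dtheta = eps * F1(theta, r) + O(eps^2); for 0 < r < 1/8 the
   quotient is a rational function of eps with denominator 1 at eps = 0. *)
definition F1 :: "(real \<Rightarrow> plane_field) \<Rightarrow> real \<Rightarrow> real \<Rightarrow> real" where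
  "F1 Z \<theta> r = deriv (\<lambda>\<epsilon>. dr_dtheta (Z \<epsilon>) \<theta> r) 0"

definition averaged1 :: "(real \<Rightarrow> plane_field) \<Rightarrow> real \<Rightarrow> real" where
  "averaged1 Z r = integral {-pi..pi} (\<lambda>\<theta>. F1 Z \<theta> r)"

definition simple_zeros :: "(real \<Rightarrow> real) \<Rightarrow> real set \<Rightarrow> real set" where
  "simple_zeros f I =
     {\<rho> \<in> I. f \<rho> = 0 \<and> (\<exists>D. (f has_real_derivative D) (at \<rho>) \<and> D \<noteq> 0)}"

end

theory Submission
  imports Defs
begin

text \<open>
  Put \<open>R = 8 r\<close>, \<open>q = sqrt (1 - R^2)\<close> and \<open>s = 1 - R cos \<theta>\<close>. Along the unperturbed orbit of radius
  \<open>r\<close> the original coordinates are \<open>x = 3 R sin \<theta> / (8 s)\<close> and \<open>y = 3 (1 - q^2 / s^2) / 16\<close>, and the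
  radial speed produced by a perturbation \<open>(P, Q)\<close> is
  \<open>(8/3 q^2 s x P + s (s - q^2) Q) / (3 R)\<close>. For quadratic \<open>P\<close> and \<open>Q\<close> this is a Laurent polynomial in
  \<open>s\<close> plus \<open>sin \<theta>\<close> times another one, so its integral over a half turn is elementary. The
  reflection \<open>\<theta> \<mapsto> - \<theta>\<close> turns the half-plane \<open>x < 0\<close> into the other one, so both halves contribute
  functions of the same shape. Altogether the averaged function is a positive factor times
    \<open>\<Phi>(R) = (1 - q) (A / q^2 + B / q + C) + R (D / q^2 + E) + G ln ((1 + R) / (1 - R))\<close>,
  where \<open>A, \<dots>, G\<close> depend linearly on the perturbation and take all real values
  (\<open>averaged1_in_avg_family\<close>, \<open>avg_family_realised\<close>).

  Differentiation removes the logarithm: with \<open>c = 1 / R > 1\<close> and \<open>t = sqrt (c^2 - 1)\<close>, the function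
  \<open>\<Phi>'\<close> is a positive factor times a combination of the six functions \<open>1, c^2, c^3, c^4, t, t c^2\<close>.
  Dividing by one of the functions and differentiating, again and again, shows that a nontrivial
  combination has at most five zeros (\<open>cheb_zeros\<close>). Since \<open>\<Phi>(0) = 0\<close>, Rolle's theorem gives
  \<open>\<Phi>'\<close> at least as many zeros as \<open>\<Phi>\<close> has in \<open>(0, 1)\<close>, at points where \<open>\<Phi>\<close> does not vanish.
  A multiple zero of \<open>\<Phi>\<close> would be an additional zero of \<open>\<Phi>'\<close>. Hence a nontrivial \<open>\<Phi>\<close> has at most five zeros,
  and if it has five they are all simple (\<open>avg_family_zeros_interlace\<close>). This makes the sharpness
  a matter of linear algebra: six coefficients suffice to force a nontrivial \<open>\<Phi>\<close> to vanish at
  five prescribed points.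
\<close>


section \<open>Counting zeros with Rolle\<close>

text \<open>Keeping the zeros of the derivative apart from those of the function allows a multiple zero of
  \<open>f\<close> to be counted as a further zero of \<open>f'\<close>.\<close>
lemma rolle_interlacing:
  fixes f f' :: "real \<Rightarrow> real"
  assumes "finite Z" "Z \<noteq> {}" "\<And>z. z \<in> Z \<Longrightarrow> f z = 0"
    and "\<And>x. x \<in> {Min Z..Max Z} \<Longrightarrow> (f has_real_derivative f' x) (at x)"
  shows "\<exists>W. finite W \<and> Suc (card W) = card Z \<and> W \<subseteq> {Min Z<..<Max Z} - Z \<and> (\<forall>w\<in>W. f' w = 0)"
  using assms
proof (induction Z rule: finite_linorder_max_induct)
  case empty
  then show ?case by simp
next
  case (insert b A)
  show ?case
  proof (cases "A = {}")
    case True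
    then show ?thesis by (intro exI[of _ "{}"]) auto
  next
    case False
    have ends: "Max A < b" "Min A \<le> Max A"
      using insert.hyps False by auto
    then have le: "Max A < b" "Min (insert b A) = Min A" "Max (insert b A) = b" "Min A \<le> Max A"
      using insert.hyps(1) False by (simp_all add: min_absorb2 max_absorb1)
    have "\<exists>W. finite W \<and> Suc (card W) = card A \<and> W \<subseteq> {Min A<..<Max A} - A \<and> (\<forall>w\<in>W. f' w = 0)"
      using insert.prems le by (intro insert.IH) (auto simp: False)
    then obtain W where W: "finite W" "Suc (card W) = card A" "W \<subseteq> {Min A<..<Max A} - A"
        "\<forall>w\<in>W. f' w = 0"
      by blast
    have der: "(f has_real_derivative f' x) (at x)" if "Max A \<le> x" "x \<le> b" for x
      using insert.prems(3)[of x] that le by auto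
    have "\<exists>z>Max A. z < b \<and> DERIV f z :> 0"
    proof (rule Rolle)
      show "f (Max A) = f b"
        using insert.prems(2) False insert.hyps(1) by simp
      show "continuous_on {Max A..b} f"
        by (meson DERIV_continuous_on der atLeastAtMost_iff has_field_derivative_at_within)
      show "f differentiable at x" if "Max A < x" "x < b" for x
        using der[of x] that real_differentiable_def by auto
    qed (use le in auto)
    then obtain z where z: "Max A < z" "z < b" "DERIV f z :> 0" by blast
    then have "f' z = 0" using der[of z] DERIV_unique by auto
    moreover have "z \<notin> W" "z \<notin> A"
      using W(3) z(1) insert.hyps(1) by (auto dest: Max_ge)
    moreover have "insert z W \<subseteq> {Min A<..<b} - insert b A"
    proof
      fix x assume "x \<in> insert z W"
      moreover have "z \<in> {Min A<..<b} - insert b A"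
        using z(1,2) le(4) \<open>z \<notin> A\<close> by simp
      moreover have "x \<in> {Min A<..<b} - insert b A" if "x \<in> W"
        using subsetD[OF W(3) that] le(1) by simp
      ultimately show "x \<in> {Min A<..<b} - insert b A" by blast
    qed
    moreover have "Suc (card (insert z W)) = card (insert b A)"
      using W(1,2) \<open>z \<notin> W\<close> insert.hyps by auto
    ultimately show ?thesis
      using W(1,4) unfolding le(2,3) by (intro exI[of _ "insert z W"] conjI) simp_all
  qed
qed

definition at_most_zeros :: "nat \<Rightarrow> (real \<Rightarrow> real) \<Rightarrow> real set \<Rightarrow> bool" where
  "at_most_zeros n f I \<longleftrightarrow> finite {x \<in> I. f x = 0} \<and> card {x \<in> I. f x = 0} \<le> n"

text \<open>Only finite sets of zeros have to be bounded: an infinite zero set has finite subsets of every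
  size.\<close>
lemma at_most_zerosI:
  assumes "\<And>Z. Z \<subseteq> {x \<in> I. f x = 0} \<Longrightarrow> finite Z \<Longrightarrow> card Z \<le> n"
  shows "at_most_zeros n f I"
  unfolding at_most_zeros_def by (rule finite_if_finite_subsets_card_bdd) (simp add: assms)

lemma at_most_zeros_card_le:
  assumes "at_most_zeros n f I" "Z \<subseteq> {x \<in> I. f x = 0}"
  shows "card Z \<le> n"
  using card_mono[OF _ assms(2)] assms(1) unfolding at_most_zeros_def by linarith

lemma at_most_zeros_nonzero: "(\<And>x. x \<in> I \<Longrightarrow> f x \<noteq> 0) \<Longrightarrow> at_most_zeros n f I"
proof -
  assume "\<And>x. x \<in> I \<Longrightarrow> f x \<noteq> 0"
  then have none: "{x \<in> I. f x = 0} = {}" by blast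
  show ?thesis unfolding at_most_zeros_def none by simp
qed

text \<open>The nowhere vanishing weight \<open>w\<close> is what makes the division step possible: a factor common
  to all terms of the derivative can be dropped before the next differentiation.\<close>
lemma rolle_at_most_zeros:
  assumes "is_interval I"
    and der: "\<And>x. x \<in> I \<Longrightarrow> (f has_real_derivative w x * g x) (at x)"
    and w: "\<And>x. x \<in> I \<Longrightarrow> w x \<noteq> 0"
    and g: "at_most_zeros n g I"
  shows "at_most_zeros (Suc n) f I"
proof (rule at_most_zerosI)
  fix Z assume Z: "Z \<subseteq> {x \<in> I. f x = 0}" "finite Z"
  show "card Z \<le> Suc n"
  proof (cases "Z = {}")
    case False
    have sub: "{Min Z..Max Z} \<subseteq> I"
    proof
      fix x assume "x \<in> {Min Z..Max Z}"
      moreover have "Min Z \<in> I" "Max Z \<in> I"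
        using subsetD[OF Z(1)] Min_in[OF Z(2) False] Max_in[OF Z(2) False] by simp_all
      ultimately show "x \<in> I"
        using mem_is_interval_1_I[OF assms(1), of "Min Z" "Max Z" x] by simp
    qed
    have "\<exists>W. finite W \<and> Suc (card W) = card Z \<and> W \<subseteq> {Min Z<..<Max Z} - Z \<and>
        (\<forall>x\<in>W. w x * g x = 0)"
    proof (rule rolle_interlacing[OF Z(2) False])
      show "f z = 0" if "z \<in> Z" for z using Z(1) that by blast
      show "(f has_real_derivative w x * g x) (at x)" if "x \<in> {Min Z..Max Z}" for x
        using der subsetD[OF sub that] .
    qed
    then obtain W where W: "Suc (card W) = card Z" "W \<subseteq> {Min Z<..<Max Z} - Z"
        "\<forall>x\<in>W. w x * g x = 0"
      by blast
    have "x \<in> I \<and> g x = 0" if "x \<in> W" for x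
    proof
      show "x \<in> I" using subsetD[OF W(2) that] by (intro subsetD[OF sub]) simp
      then show "g x = 0" using W(3) w[of x] that by auto
    qed
    then have "W \<subseteq> {x \<in> I. g x = 0}" by blast
    then have "card W \<le> n" by (rule at_most_zeros_card_le[OF g])
    then show ?thesis using W(1) by linarith
  qed simp
qed

section \<open>A six-dimensional Chebyshev system\<close>

lemma sqrt_square_minus_1:
  fixes c :: real
  assumes "c > 1"
  defines "s \<equiv> sqrt (c^2 - 1)"
  shows "s > 0" "s^2 = c^2 - 1" "((\<lambda>c. sqrt (c^2 - 1)) has_real_derivative c / s) (at c)"
proof -
  have "c^2 > 1" using assms(1) by (simp add: power2_eq_square less_1_mult)
  then show "s > 0" "s^2 = c^2 - 1" by (auto simp: s_def)
  show "((\<lambda>c. sqrt (c^2 - 1)) has_real_derivative c / s) (at c)"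
    using \<open>c^2 > 1\<close> unfolding s_def
    by (auto intro!: derivative_eq_intros simp: field_simps)
qed

text \<open>The shape that the derivative of the averaged function takes in the variable \<open>c = 1 / R\<close>.\<close>
definition cheb :: "real \<Rightarrow> real \<Rightarrow> real \<Rightarrow> real \<Rightarrow> real \<Rightarrow> real \<Rightarrow> real \<Rightarrow> real" where
  "cheb a b d e g h c = a + b * c^2 + d * c^3 + e * c^4 + sqrt (c^2 - 1) * (g + h * c^2)"

text \<open>The last member of the chain of derivatives that starts from \<^const>\<open>cheb\<close>. Its own derivative is
  \<open>8 e c^5 + 3 d\<close> up to a positive factor, and \<open>c^5\<close> is injective.\<close>
lemma cheb_derivative_3_zeros:
  assumes "d \<noteq> 0 \<or> e \<noteq> 0 \<or> h \<noteq> 0"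
  shows "at_most_zeros 2 (\<lambda>c. h + 8 * e * sqrt (c^2 - 1) + d * sqrt (c^2 - 1) * (2 / c + 1 / c^3)) {1<..}"
proof (cases "d = 0 \<and> e = 0")
  case True
  then show ?thesis using assms by (intro at_most_zeros_nonzero) auto
next
  case False
  have "at_most_zeros 1 (\<lambda>c. 8 * e * c^5 + 3 * d) {1<..}"
  proof (rule at_most_zerosI)
    fix Z assume Z: "Z \<subseteq> {c \<in> {1<..}. 8 * e * c^5 + 3 * d = 0}"
    have "x = y" if "x \<in> Z" "y \<in> Z" for x y
    proof -
      have x: "x > 1" "8 * e * x^5 + 3 * d = 0" and y: "y > 1" "8 * e * y^5 + 3 * d = 0"
        using Z that by auto
      then have "e \<noteq> 0" using False by auto
      moreover have "8 * e * x^5 = 8 * e * y^5" using x y by linarith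
      ultimately have "x^5 = y^5" by simp
      then show ?thesis using x(1) y(1) by (simp add: power_eq_iff_eq_base)
    qed
    then show "card Z \<le> 1"
      using card_le_Suc0_iff_eq[of Z] card.infinite[of Z] by fastforce
  qed
  then have "at_most_zeros (Suc 1)
      (\<lambda>c. h + 8 * e * sqrt (c^2 - 1) + d * sqrt (c^2 - 1) * (2 / c + 1 / c^3)) {1<..}"
  proof (rule rolle_at_most_zeros[rotated 3])
    fix c :: real assume "c \<in> {1<..}"
    then have c: "c > 1" by simp
    define t where "t = sqrt (c^2 - 1)"
    note s = sqrt_square_minus_1[OF c, folded t_def]
    \<comment> \<open>the derivative over the common denominator \<open>t\<close>, after \<open>t^2\<close> has been replaced by \<open>c^2 - 1\<close>\<close>
    have inner: "8 * e * c + d * (2 + 1 / c^2 - (c^2 - 1) * (2 / c^2 + 3 / c^4)) = (8 * e * c^5 + 3 * d) / c^4"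
      using c by (simp add: divide_simps) (simp add: algebra_simps eval_nat_numeral)
    have "((\<lambda>c. 2 / c + 1 / c^3) has_real_derivative - (2 / c^2 + 3 / c^4)) (at c)"
      by (rule derivative_eq_intros refl | (use c in force))+
         (use c in \<open>simp add: field_simps eval_nat_numeral\<close>)
    then have "((\<lambda>c. h + 8 * e * sqrt (c^2 - 1) + d * (sqrt (c^2 - 1) * (2 / c + 1 / c^3)))
        has_real_derivative 0 + 8 * e * (c / t) +
          d * (c / t * (2 / c + 1 / c^3) + - (2 / c^2 + 3 / c^4) * t)) (at c)"
      unfolding t_def
      by (intro DERIV_add DERIV_const DERIV_cmult DERIV_mult s(3)[unfolded t_def])
    also have "0 + 8 * e * (c / t) + d * (c / t * (2 / c + 1 / c^3) + - (2 / c^2 + 3 / c^4) * t) =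
        (8 * e * c + d * (2 + 1 / c^2 - t^2 * (2 / c^2 + 3 / c^4))) / t"
      using c s(1) by (simp add: divide_simps) (simp add: algebra_simps eval_nat_numeral)
    also have "\<dots> = 1 / (t * c^4) * (8 * e * c^5 + 3 * d)"
      unfolding s(2) inner by simp
    finally show "((\<lambda>c. h + 8 * e * sqrt (c^2 - 1) + d * sqrt (c^2 - 1) * (2 / c + 1 / c^3))
        has_real_derivative 1 / (sqrt (c^2 - 1) * c^4) * (8 * e * c^5 + 3 * d)) (at c)"
      by (simp add: mult.assoc t_def)
    show "1 / (sqrt (c^2 - 1) * c^4) \<noteq> 0" using c s(1) by (simp flip: t_def)
  qed (simp add: is_interval_1)
  then show ?thesis by (simp add: numeral_2_eq_2)
qed

text \<open>Differentiation kills the constant \<open>b\<close>, and \<open>c / sqrt (c^2 - 1)\<close> factors out of what remains.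
  If all other coefficients vanish, then the function is a nonzero constant; the same alternative
  occurs at every stage of the chain.\<close>
lemma cheb_derivative_2_zeros:
  assumes "b \<noteq> 0 \<or> d \<noteq> 0 \<or> e \<noteq> 0 \<or> h \<noteq> 0"
  shows "at_most_zeros 3 (\<lambda>c. b + 12 * e * c^2 + d * (6 * c - 3 / c) + 6 * h * sqrt (c^2 - 1)) {1<..}"
proof (cases "d = 0 \<and> e = 0 \<and> h = 0")
  case True
  then show ?thesis using assms by (intro at_most_zeros_nonzero) auto
next
  case False
  then have "at_most_zeros 2 (\<lambda>c. h + 4 * e * sqrt (c^2 - 1) + d / 2 * sqrt (c^2 - 1) * (2 / c + 1 / c^3)) {1<..}"
    using cheb_derivative_3_zeros[of "d / 2" "e / 2" "h"] by simp
  then have "at_most_zeros (Suc 2) (\<lambda>c. b + 12 * e * c^2 + d * (6 * c - 3 / c) + 6 * h * sqrt (c^2 - 1)) {1<..}"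
  proof (rule rolle_at_most_zeros[rotated 3])
    fix c :: real assume "c \<in> {1<..}"
    then have c: "c > 1" by simp
    define t where "t = sqrt (c^2 - 1)"
    note s = sqrt_square_minus_1[OF c, folded t_def]
    have "((\<lambda>c. b + 12 * e * c^2 + d * (6 * c - 3 / c)) has_real_derivative
        24 * e * c + d * (6 + 3 / c^2)) (at c)"
      by (rule derivative_eq_intros refl | (use c in force))+ (simp add: power2_eq_square)
    then have "((\<lambda>c. b + 12 * e * c^2 + d * (6 * c - 3 / c) + 6 * h * sqrt (c^2 - 1))
        has_real_derivative 24 * e * c + d * (6 + 3 / c^2) + 6 * h * (c / t)) (at c)"
      by (rule DERIV_add[OF _ DERIV_cmult[OF s(3)]])
    also have "24 * e * c + d * (6 + 3 / c^2) + 6 * h * (c / t) =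
        6 * c / t * (h + 4 * e * t + d * t * (2 / c + 1 / c^3)  * (1/2))"
      using c s(1) by (simp add: divide_simps) (simp add: algebra_simps eval_nat_numeral)
    finally show "((\<lambda>c. b + 12 * e * c^2 + d * (6 * c - 3 / c) + 6 * h * sqrt (c^2 - 1))
        has_real_derivative 6 * c / sqrt (c^2 - 1) *
          (h + 4 * e * sqrt (c^2 - 1) + d / 2 * sqrt (c^2 - 1) * (2 / c + 1 / c^3))) (at c)"
      by (simp add: t_def)
    show "6 * c / sqrt (c^2 - 1) \<noteq> 0" using c s(1) by (simp flip: t_def)
  qed (simp add: is_interval_1)
  then show ?thesis by (simp add: eval_nat_numeral)
qed

text \<open>The constant term is \<open>- a - 2 b\<close>, and the coefficient of \<open>c^2\<close> is \<open>b - 4 e\<close>. This is why the case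
  distinction below is on \<open>b - 4 e\<close>: if it and \<open>d\<close>, \<open>e\<close>, \<open>h\<close> vanish, then \<open>b\<close> vanishes too and only
  the constant \<open>- a\<close> is left.\<close>
lemma cheb_derivative_1_zeros:
  assumes "a \<noteq> 0 \<or> b \<noteq> 0 \<or> d \<noteq> 0 \<or> e \<noteq> 0 \<or> h \<noteq> 0"
  shows "at_most_zeros 4 (\<lambda>c. - a + b * (c^2 - 2) + d * (2 * c^3 - 3 * c) + e * (3 * c^4 - 4 * c^2) +
    2 * h * sqrt (c^2 - 1)^3) {1<..}"
proof (cases "b - 4 * e = 0 \<and> d = 0 \<and> e = 0 \<and> h = 0")
  case True
  then show ?thesis using assms by (intro at_most_zeros_nonzero) auto
next
  case False
  then have "at_most_zeros 3 (\<lambda>c. 2 * (b - 4 * e) + 12 * e * c^2 + d * (6 * c - 3 / c) +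
      6 * h * sqrt (c^2 - 1)) {1<..}"
    by (intro cheb_derivative_2_zeros) auto
  then have "at_most_zeros (Suc 3) (\<lambda>c. - a + b * (c^2 - 2) + d * (2 * c^3 - 3 * c) +
      e * (3 * c^4 - 4 * c^2) + 2 * h * sqrt (c^2 - 1)^3) {1<..}"
  proof (rule rolle_at_most_zeros[rotated 3])
    fix c :: real assume "c \<in> {1<..}"
    then have c: "c > 1" by simp
    define t where "t = sqrt (c^2 - 1)"
    note s = sqrt_square_minus_1[OF c, folded t_def]
    have "((\<lambda>c. - a + b * (c^2 - 2) + d * (2 * c^3 - 3 * c) + e * (3 * c^4 - 4 * c^2))
        has_real_derivative 2 * b * c + d * (6 * c^2 - 3) + e * (12 * c^3 - 8 * c)) (at c)"
      by (auto intro!: derivative_eq_intros)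
    then have "((\<lambda>c. - a + b * (c^2 - 2) + d * (2 * c^3 - 3 * c) + e * (3 * c^4 - 4 * c^2) +
        2 * h * sqrt (c^2 - 1)^3) has_real_derivative
        2 * b * c + d * (6 * c^2 - 3) + e * (12 * c^3 - 8 * c) +
        2 * h * (of_nat 3 * (c / t * t^(3 - Suc 0)))) (at c)"
      unfolding t_def by (rule DERIV_add[OF _ DERIV_cmult[OF DERIV_power[OF s(3)[unfolded t_def]]]])
    also have "2 * b * c + d * (6 * c^2 - 3) + e * (12 * c^3 - 8 * c) +
        2 * h * (of_nat 3 * (c / t * t^(3 - Suc 0))) =
        c * (2 * (b - 4 * e) + 12 * e * c^2 + d * (6 * c - 3 / c) + 6 * h * t)"
      using c s(1) by (simp add: divide_simps) (simp add: algebra_simps eval_nat_numeral)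
    finally show "((\<lambda>c. - a + b * (c^2 - 2) + d * (2 * c^3 - 3 * c) + e * (3 * c^4 - 4 * c^2) +
        2 * h * sqrt (c^2 - 1)^3) has_real_derivative
        c * (2 * (b - 4 * e) + 12 * e * c^2 + d * (6 * c - 3 / c) + 6 * h * sqrt (c^2 - 1))) (at c)"
      by (simp only: t_def)
    show "c \<noteq> 0" using c by simp
  qed (simp add: is_interval_1)
  then show ?thesis by (simp add: eval_nat_numeral)
qed

text \<open>Division by \<open>sqrt (c^2 - 1)\<close> turns the term with coefficient \<open>g\<close> into a constant.\<close>
theorem cheb_zeros:
  assumes "a \<noteq> 0 \<or> b \<noteq> 0 \<or> d \<noteq> 0 \<or> e \<noteq> 0 \<or> g \<noteq> 0 \<or> h \<noteq> 0"
  shows "at_most_zeros 5 (cheb a b d e g h) {1<..}"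
proof -
  let ?f = "\<lambda>c. g + h * c^2 + (a + b * c^2 + d * c^3 + e * c^4) / sqrt (c^2 - 1)"
  have "at_most_zeros 5 ?f {1<..}"
  proof (cases "a = 0 \<and> b = 0 \<and> d = 0 \<and> e = 0 \<and> h = 0")
    case True
    then show ?thesis using assms by (intro at_most_zeros_nonzero) auto
  next
    case False
    then have "at_most_zeros 4 (\<lambda>c. - a + b * (c^2 - 2) + d * (2 * c^3 - 3 * c) +
        e * (3 * c^4 - 4 * c^2) + 2 * h * sqrt (c^2 - 1)^3) {1<..}"
      by (intro cheb_derivative_1_zeros) auto
    then have "at_most_zeros (Suc 4) ?f {1<..}"
    proof (rule rolle_at_most_zeros[rotated 3])
      fix c :: real assume "c \<in> {1<..}"
      then have c: "c > 1" by simp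
      define t where "t = sqrt (c^2 - 1)"
      note s = sqrt_square_minus_1[OF c, folded t_def]
      let ?p = "a + b * c^2 + d * c^3 + e * c^4"
      let ?p' = "2 * b * c + 3 * d * c^2 + 4 * e * c^3"
      have p: "((\<lambda>c. a + b * c^2 + d * c^3 + e * c^4) has_real_derivative ?p') (at c)"
        by (auto intro!: derivative_eq_intros)
      have "((\<lambda>c. g + h * c^2) has_real_derivative 2 * h * c) (at c)"
        by (auto intro!: derivative_eq_intros)
      from DERIV_add[OF this DERIV_divide[OF p s(3)]]
      have "(?f has_real_derivative 2 * h * c + (?p' * t - ?p * (c / t)) / (t * t)) (at c)"
        using s(1) by (simp flip: t_def)
      also have "2 * h * c + (?p' * t - ?p * (c / t)) / (t * t) =
          c / t^3 * ((?p' * t^2 - ?p * c) / c + 2 * h * t^3)"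
        using c s(1) by (simp add: divide_simps) (simp add: algebra_simps eval_nat_numeral)
      also have "(?p' * t^2 - ?p * c) / c =
          - a + b * (c^2 - 2) + d * (2 * c^3 - 3 * c) + e * (3 * c^4 - 4 * c^2)"
        unfolding s(2) using c by (simp add: divide_simps) (simp add: algebra_simps eval_nat_numeral)
      finally show "(?f has_real_derivative c / sqrt (c^2 - 1)^3 *
          (- a + b * (c^2 - 2) + d * (2 * c^3 - 3 * c) + e * (3 * c^4 - 4 * c^2) +
           2 * h * sqrt (c^2 - 1)^3)) (at c)"
        by (simp only: t_def)
      show "c / sqrt (c^2 - 1)^3 \<noteq> 0" using c s(1) by (simp flip: t_def)
    qed (simp add: is_interval_1)
    then show ?thesis by (simp add: eval_nat_numeral)
  qed
  moreover have "{c \<in> {1<..}. ?f c = 0} = {c \<in> {1<..}. cheb a b d e g h c = 0}"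
  proof (intro Collect_cong conj_cong refl)
    fix c :: real assume "c \<in> {1<..}"
    then have c: "c > 1" by simp
    define t where "t = sqrt (c^2 - 1)"
    show "?f c = 0 \<longleftrightarrow> cheb a b d e g h c = 0"
      using sqrt_square_minus_1(1)[OF c] unfolding cheb_def t_def[symmetric]
      by (simp add: add_divide_eq_iff add_eq_0_iff2 field_simps)
  qed
  ultimately show ?thesis by (simp add: at_most_zeros_def)
qed

section \<open>The family of averaged functions\<close>

text \<open>Up to a positive factor, the averaged functions at \<open>r = R / 8\<close>. The formula makes sense on
  \<open>(-1, 1)\<close>, so that the zero \<open>R = 0\<close> is an interior point with a two-sided derivative.\<close>
definition avg_family :: "real \<Rightarrow> real \<Rightarrow> real \<Rightarrow> real \<Rightarrow> real \<Rightarrow> real \<Rightarrow> real \<Rightarrow> real" where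
  "avg_family A B C D E G R =
     (let q = sqrt (1 - R^2) in
      (1 - q) * (A / q^2 + B / q + C) + R * (D / q^2 + E) + G * (ln (1 + R) - ln (1 - R)))"

definition avg_family_deriv :: "real \<Rightarrow> real \<Rightarrow> real \<Rightarrow> real \<Rightarrow> real \<Rightarrow> real \<Rightarrow> real \<Rightarrow> real" where
  "avg_family_deriv A B C D E G R =
     (let q = sqrt (1 - R^2) in
      (R * (2 * A + (B - A) * q + C * q^3) + D * (2 - q^2) + E * q^4 + 2 * G * q^2) / q^4)"

lemma sqrt_1_minus_square:
  fixes R :: real
  assumes "\<bar>R\<bar> < 1"
  defines "q \<equiv> sqrt (1 - R^2)"
  shows "q > 0" "q^2 = 1 - R^2" "((\<lambda>R. sqrt (1 - R^2)) has_real_derivative - R / q) (at R)"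
proof -
  have "R^2 < 1" using assms(1) by (simp add: abs_square_less_1)
  then show "q > 0" "q^2 = 1 - R^2" by (auto simp: q_def)
  show "((\<lambda>R. sqrt (1 - R^2)) has_real_derivative - R / q) (at R)"
    using \<open>R^2 < 1\<close> unfolding q_def
    by (auto intro!: derivative_eq_intros simp: field_simps)
qed

lemma avg_family_has_derivative:
  assumes "\<bar>R\<bar> < 1"
  shows "(avg_family A B C D E G has_real_derivative avg_family_deriv A B C D E G R) (at R)"
proof -
  define q where "q = sqrt (1 - R^2)"
  note q = sqrt_1_minus_square[OF assms, folded q_def]
  have R: "-1 < R" "R < 1" using assms by auto
  have k: "q^2 = (1 + R) * (1 - R)" unfolding q(2) by (simp add: power2_eq_square algebra_simps)
  have "((\<lambda>q. (1 - q) * (A / q^2 + B / q + C)) has_real_derivative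
      - (2 * A + (B - A) * q + C * q^3) / q^3) (at q)"
  proof -
    have "((\<lambda>q. A / q^2 + B / q + C) has_real_derivative - (2 * A / q^3 + B / q^2)) (at q)"
      using q(1) by (auto intro!: derivative_eq_intros simp: field_simps eval_nat_numeral)
    then have "((\<lambda>q. (1 - q) * (A / q^2 + B / q + C)) has_real_derivative
        (0 - 1) * (A / q^2 + B / q + C) + - (2 * A / q^3 + B / q^2) * (1 - q)) (at q)"
      by (intro DERIV_mult DERIV_diff DERIV_const DERIV_ident)
    also have "(0 - 1) * (A / q^2 + B / q + C) + - (2 * A / q^3 + B / q^2) * (1 - q) =
        - (2 * A + (B - A) * q + C * q^3) / q^3"
      using q(1) by (simp add: divide_simps) (simp add: algebra_simps eval_nat_numeral)
    finally show ?thesis .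
  qed
  from DERIV_chain2[OF this[unfolded q_def] q(3)]
  have even: "((\<lambda>R. (1 - sqrt (1 - R^2)) * (A / sqrt (1 - R^2)^2 + B / sqrt (1 - R^2) + C))
      has_real_derivative - (2 * A + (B - A) * q + C * q^3) / q^3 * (- R / q)) (at R)"
    by (simp only: q_def)
  have "((\<lambda>R. D / sqrt (1 - R^2)^2 + E) has_real_derivative 2 * D * R / q^4) (at R)"
  proof -
    have "((\<lambda>q. D / q^2 + E) has_real_derivative - 2 * D / q^3) (at q)"
      using q(1) by (auto intro!: derivative_eq_intros simp: field_simps eval_nat_numeral)
    from DERIV_chain2[OF this[unfolded q_def] q(3)]
    have "((\<lambda>R. D / sqrt (1 - R^2)^2 + E) has_real_derivative - 2 * D / q^3 * (- R / q)) (at R)"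
      by (simp only: q_def)
    also have "- 2 * D / q^3 * (- R / q) = 2 * D * R / q^4"
      by (simp add: eval_nat_numeral)
    finally show ?thesis .
  qed
  from DERIV_mult[OF DERIV_ident this]
  have odd: "((\<lambda>R. R * (D / sqrt (1 - R^2)^2 + E)) has_real_derivative
      1 * (D / q^2 + E) + 2 * D * R / q^4 * R) (at R)"
    by (simp only: q_def)
  have "((\<lambda>R. ln (1 + R) - ln (1 - R)) has_real_derivative 1 / (1 + R) + 1 / (1 - R)) (at R)"
    using R by (auto intro!: derivative_eq_intros)
  also have "1 / (1 + R) + 1 / (1 - R) = 2 / q^2"
    unfolding k using R by (simp add: field_simps)
  finally have log: "((\<lambda>R. ln (1 + R) - ln (1 - R)) has_real_derivative 2 / q^2) (at R)" .
  have "((\<lambda>R. (1 - sqrt (1 - R^2)) * (A / sqrt (1 - R^2)^2 + B / sqrt (1 - R^2) + C) +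
        R * (D / sqrt (1 - R^2)^2 + E) + G * (ln (1 + R) - ln (1 - R))) has_real_derivative
      - (2 * A + (B - A) * q + C * q^3) / q^3 * (- R / q) +
        (1 * (D / q^2 + E) + 2 * D * R / q^4 * R) + G * (2 / q^2)) (at R)"
    by (intro DERIV_add DERIV_cmult even odd log)
  also have "- (2 * A + (B - A) * q + C * q^3) / q^3 * (- R / q) +
        (1 * (D / q^2 + E) + 2 * D * R / q^4 * R) + G * (2 / q^2) =
      (R * (2 * A + (B - A) * q + C * q^3) + D * (q^2 + 2 * R^2) + E * q^4 + 2 * G * q^2) / q^4"
    using q(1) by (simp add: divide_simps) (simp add: algebra_simps eval_nat_numeral)
  also have "q^2 + 2 * R^2 = 2 - q^2" using q(2) by simp
  finally show ?thesis
    unfolding avg_family_def[abs_def] avg_family_deriv_def Let_def q_def .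
qed

text \<open>In terms of \<open>c = 1 / R\<close> one has \<open>sqrt (c^2 - 1) = q / R\<close>, and the numerator of the derivative is
  homogeneous enough to become \<open>R^4\<close> times a combination of the Chebyshev system. The six
  coefficients on the right vanish only if \<open>A, \<dots>, G\<close> all vanish.\<close>
lemma avg_family_deriv_eq_cheb:
  assumes "0 < R" "R < 1"
  shows "avg_family_deriv A B C D E G R * (1 - R^2)^2 =
    R^4 * cheb E (D - 2 * E - 2 * G) (2 * A) (D + E + 2 * G) (- C) (B - A + C) (1 / R)"
proof -
  define q where "q = sqrt (1 - R^2)"
  have "\<bar>R\<bar> < 1" using assms by simp
  note q = sqrt_1_minus_square[OF this, folded q_def]
  have q4: "(1 - R^2)^2 = q^4" unfolding q(2)[symmetric] by simp
  have "(1 / R)^2 - 1 = (q / R)^2"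
    using assms by (simp add: power_divide q(2) field_simps)
  then have s: "sqrt ((1 / R)^2 - 1) = q / R" using q(1) assms by simp
  have "R^4 * cheb E (D - 2 * E - 2 * G) (2 * A) (D + E + 2 * G) (- C) (B - A + C) (1 / R) =
      E * (1 - R^2)^2 + (D - 2 * G) * R^2 + D + 2 * G + 2 * A * R + q * R * ((B - A + C) - C * R^2)"
    unfolding cheb_def s using assms
    by (simp add: divide_simps) (simp add: algebra_simps eval_nat_numeral)
  also have "R^2 = 1 - q^2" using q(2) by simp
  finally show ?thesis
    unfolding avg_family_deriv_def Let_def q_def[symmetric] q4 using q(1)
    by simp (simp add: algebra_simps eval_nat_numeral)
qed

lemma avg_family_deriv_zeros:
  assumes "A \<noteq> 0 \<or> B \<noteq> 0 \<or> C \<noteq> 0 \<or> D \<noteq> 0 \<or> E \<noteq> 0 \<or> G \<noteq> 0"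
  shows "at_most_zeros 5 (avg_family_deriv A B C D E G) {0<..<1}"
proof (rule at_most_zerosI)
  fix Z assume Z: "Z \<subseteq> {R \<in> {0<..<1}. avg_family_deriv A B C D E G R = 0}"
  let ?h = "cheb E (D - 2 * E - 2 * G) (2 * A) (D + E + 2 * G) (- C) (B - A + C)"
  have "at_most_zeros 5 ?h {1<..}"
    using assms by (intro cheb_zeros) auto
  moreover have "(\<lambda>R. 1 / R) ` Z \<subseteq> {c \<in> {1<..}. ?h c = 0}"
  proof (intro image_subsetI)
    fix R assume "R \<in> Z"
    then have R: "0 < R" "R < 1" "avg_family_deriv A B C D E G R = 0" using Z by auto
    then show "1 / R \<in> {c \<in> {1<..}. ?h c = 0}"
      using avg_family_deriv_eq_cheb[of R A B C D E G] by simp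
  qed
  ultimately have "card ((\<lambda>R. 1 / R) ` Z) \<le> 5" by (rule at_most_zeros_card_le)
  moreover have "inj_on (\<lambda>R. 1 / R) Z" by (auto simp: inj_on_def)
  ultimately show "card Z \<le> 5" by (simp add: card_image)
qed

text \<open>Rolle's theorem is applied to the zeros in \<open>Z\<close> together with the zero at \<open>R = 0\<close>, so it yields as many
  zeros of the derivative as \<open>Z\<close> has elements. The points of \<open>Z\<close> where the derivative vanishes come
  on top of these, because the zeros from Rolle's theorem avoid \<open>Z\<close>.\<close>
lemma avg_family_zeros_interlace:
  assumes "A \<noteq> 0 \<or> B \<noteq> 0 \<or> C \<noteq> 0 \<or> D \<noteq> 0 \<or> E \<noteq> 0 \<or> G \<noteq> 0"
    and Z: "finite Z" "Z \<subseteq> {R \<in> {0<..<1}. avg_family A B C D E G R = 0}"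
  shows "card Z + card {R \<in> Z. avg_family_deriv A B C D E G R = 0} \<le> 5"
proof (cases "Z = {}")
  case True
  then show ?thesis by simp
next
  case False
  let ?f = "avg_family A B C D E G" and ?f' = "avg_family_deriv A B C D E G"
  have Z01: "0 < z" "z < 1" "?f z = 0" if "z \<in> Z" for z using Z(2) that by auto
  have "0 \<notin> Z" using Z01(1) by blast
  have mn: "Min (insert 0 Z) = 0"
    using Z01(1) Z(1) by (intro Min_eqI) (auto simp: less_imp_le)
  have mx: "Max (insert 0 Z) \<in> Z"
    using Max_in[OF Z(1) False] Z01(1)[OF Max_in[OF Z(1) False]] Z(1) False by (simp add: max_def)
  have "\<exists>W. finite W \<and> Suc (card W) = card (insert 0 Z) \<and>
      W \<subseteq> {Min (insert 0 Z)<..<Max (insert 0 Z)} - insert 0 Z \<and> (\<forall>w\<in>W. ?f' w = 0)"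
  proof (rule rolle_interlacing)
    show "?f z = 0" if "z \<in> insert 0 Z" for z
      using that Z01(3) by (auto simp: avg_family_def)
    show "(?f has_real_derivative ?f' x) (at x)"
      if "x \<in> {Min (insert 0 Z)..Max (insert 0 Z)}" for x
      using that Z01(2)[OF mx] unfolding mn by (intro avg_family_has_derivative) auto
  qed (use Z(1) in auto)
  then obtain W where W: "finite W" "Suc (card W) = card (insert 0 Z)"
      "W \<subseteq> {Min (insert 0 Z)<..<Max (insert 0 Z)} - insert 0 Z" "\<forall>w\<in>W. ?f' w = 0"
    by blast
  let ?D = "{R \<in> Z. ?f' R = 0}"
  have "W \<union> ?D \<subseteq> {R \<in> {0<..<1}. ?f' R = 0}"
  proof
    fix x assume "x \<in> W \<union> ?D"
    moreover have "x \<in> {R \<in> {0<..<1}. ?f' R = 0}" if "x \<in> W"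
      using subsetD[OF W(3) that] W(4) that Z01(2)[OF mx] unfolding mn by simp
    moreover have "x \<in> {R \<in> {0<..<1}. ?f' R = 0}" if "x \<in> ?D"
      using that Z01(1,2)[of x] by simp
    ultimately show "x \<in> {R \<in> {0<..<1}. ?f' R = 0}" by blast
  qed
  from at_most_zeros_card_le[OF avg_family_deriv_zeros[OF assms(1)] this]
  have "card (W \<union> ?D) \<le> 5" .
  moreover have "card (W \<union> ?D) = card W + card ?D"
    using W(1,3) Z(1) by (intro card_Un_disjoint) auto
  moreover have "card W = card Z" using W(2) \<open>0 \<notin> Z\<close> Z(1) by simp
  ultimately show ?thesis by simp
qed

lemma avg_family_add:
  "avg_family (A + A') (B + B') (C + C') (D + D') (E + E') (G + G') R =
    avg_family A B C D E G R + avg_family A' B' C' D' E' G' R"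
  unfolding avg_family_def Let_def
  by (simp only: add_divide_distrib distrib_left distrib_right ac_simps)

lemma avg_family_scale:
  "avg_family (c * A) (c * B) (c * C) (c * D) (c * E) (c * G) R = c * avg_family A B C D E G R"
  unfolding avg_family_def Let_def
  by (simp only: divide_inverse distrib_left ac_simps)

text \<open>Evaluation at five points is a linear map from a space of dimension six to one of dimension
  five, so it has a nontrivial kernel.\<close>
lemma avg_family_interpolation:
  "\<exists>A B C D E G. (A \<noteq> 0 \<or> B \<noteq> 0 \<or> C \<noteq> 0 \<or> D \<noteq> 0 \<or> E \<noteq> 0 \<or> G \<noteq> 0) \<and>
     (\<forall>R \<in> {z1, z2, z3, z4, z5}. avg_family A B C D E G R = 0)"
proof -
  define F :: "real \<times> real \<times> real \<times> real \<times> real \<times> real \<Rightarrow> real \<times> real \<times> real \<times> real \<times> real"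
    where "F = (\<lambda>(A, B, C, D, E, G). (avg_family A B C D E G z1, avg_family A B C D E G z2, avg_family A B C D E G z3,
     avg_family A B C D E G z4, avg_family A B C D E G z5))"
  have "linear F"
    by (rule linearI)
       (simp_all add: F_def case_prod_beta avg_family_add avg_family_scale)
  have "\<not> inj F"
  proof
    assume "inj F"
    then have "dim (range F) = 6" using dim_image_eq[OF \<open>linear F\<close>, of UNIV] by simp
    moreover have "dim (range F) \<le> 5" using dim_subset_UNIV[of "range F"] by simp
    ultimately show False by simp
  qed
  then obtain v where v: "F v = 0" "v \<noteq> 0"
    using linear_injective_0[OF \<open>linear F\<close>] by blast
  obtain A B C D E G where v_eq: "v = (A, B, C, D, E, G)"
    by (cases v rule: prod_cases6)
  have "A \<noteq> 0 \<or> B \<noteq> 0 \<or> C \<noteq> 0 \<or> D \<noteq> 0 \<or> E \<noteq> 0 \<or> G \<noteq> 0"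
    using v(2) unfolding v_eq zero_prod_def by blast
  moreover have "\<forall>R \<in> {z1, z2, z3, z4, z5}. avg_family A B C D E G R = 0"
    using v(1) by (simp add: v_eq F_def zero_prod_def)
  ultimately show ?thesis by blast
qed

lemma avg_family_at_most_5_zeros:
  assumes "A \<noteq> 0 \<or> B \<noteq> 0 \<or> C \<noteq> 0 \<or> D \<noteq> 0 \<or> E \<noteq> 0 \<or> G \<noteq> 0"
  shows "at_most_zeros 5 (avg_family A B C D E G) {0<..<1}"
  by (rule at_most_zerosI) (use avg_family_zeros_interlace[OF assms] in fastforce)


section \<open>Integrals over a half turn\<close>

lemma one_minus_cos_pos:
  assumes "0 < R" "R < 1"
  shows "1 - R * cos \<theta> > (0::real)"
proof -
  have "R * cos \<theta> \<le> R * 1" using assms by (intro mult_left_mono) auto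
  then show ?thesis using assms by linarith
qed

lemma has_integral_half_turn:
  fixes f :: "real \<Rightarrow> real"
  assumes "\<And>\<theta>. (f has_real_derivative f' \<theta>) (at \<theta>)"
  shows "(f' has_integral f pi - f 0) {0..pi}"
  by (rule fundamental_theorem_of_calculus)
     (use assms in \<open>auto simp: has_real_derivative_iff_has_vector_derivative[symmetric]
        intro: has_field_derivative_at_within\<close>)

context
  fixes R k q :: real
  assumes R: "0 < R" "R < 1"
  defines "k \<equiv> 1 - R^2" and "q \<equiv> sqrt (1 - R^2)"
begin

private lemma k_pos: "k > 0" and q_pos: "q > 0" and q_sq: "q^2 = k"
proof -
  have "R^2 < 1" using R by (simp add: abs_square_less_1)
  then show "k > 0" "q > 0" "q^2 = k" by (simp_all add: k_def q_def)
qed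

lemma half_turn_nonneg_powers:
  shows "((\<lambda>\<theta>. 1) has_integral pi) {0..pi}"
    and "((\<lambda>\<theta>. 1 - R * cos \<theta>) has_integral pi) {0..pi}"
    and "((\<lambda>\<theta>. (1 - R * cos \<theta>)^2) has_integral pi * (3 - k) / 2) {0..pi}"
proof -
  show "((\<lambda>\<theta>. 1) has_integral pi) {0..pi}"
    using has_integral_const_real[of "1::real" 0 pi] by simp
  have "((\<lambda>\<theta>. \<theta> - R * sin \<theta>) has_real_derivative 1 - R * cos \<theta>) (at \<theta>)" for \<theta>
    by (auto intro!: derivative_eq_intros)
  from has_integral_half_turn[OF this]
  show "((\<lambda>\<theta>. 1 - R * cos \<theta>) has_integral pi) {0..pi}" by simp
  have "((\<lambda>\<theta>. \<theta> - 2 * R * sin \<theta> + R^2 * (\<theta> + sin \<theta> * cos \<theta>) / 2)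
      has_real_derivative (1 - R * cos \<theta>)^2) (at \<theta>)" for \<theta>
  proof -
    have "((\<lambda>\<theta>. \<theta> - 2 * R * sin \<theta> + R^2 * (\<theta> + sin \<theta> * cos \<theta>) / 2)
      has_real_derivative 1 - 2 * R * cos \<theta> + R^2 * (1 + cos \<theta> * cos \<theta> - sin \<theta> * sin \<theta>) / 2) (at \<theta>)"
      by (auto intro!: derivative_eq_intros)
    also have "sin \<theta> * sin \<theta> = 1 - cos \<theta> * cos \<theta>"
      using sin_squared_eq[of \<theta>] by (simp add: power2_eq_square)
    finally show ?thesis by (simp add: power2_eq_square algebra_simps)
  qed
  from has_integral_half_turn[OF this]
  show "((\<lambda>\<theta>. (1 - R * cos \<theta>)^2) has_integral pi * (3 - k) / 2) {0..pi}"
    by (simp add: k_def algebra_simps add_divide_distrib)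
qed

text \<open>The primitive obtained from the substitution \<open>tan (\<theta> / 2)\<close> is singular at \<open>\<theta> = \<pi>\<close>. The one used
  here is smooth everywhere: it is the sum of the Fourier series
  \<open>(\<theta> + 2 \<Sum>\<^sub>n \<beta>^n sin (n \<theta>) / n) / q\<close> with \<open>\<beta> = (1 - q) / R = R / (1 + q)\<close>.\<close>
lemma half_turn_inverse: "((\<lambda>\<theta>. 1 / (1 - R * cos \<theta>)) has_integral pi / q) {0..pi}"
proof -
  have der: "((\<lambda>\<theta>. (\<theta> + 2 * arctan (R * sin \<theta> / (1 + q - R * cos \<theta>))) / q)
      has_real_derivative 1 / (1 - R * cos \<theta>)) (at \<theta>)" for \<theta>
  proof -
    define d where "d = 1 + q - R * cos \<theta>"
    define n where "n = R * sin \<theta>"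
    define s where "s = 1 - R * cos \<theta>"
    have s: "s > 0" and d: "d > 0" "d = s + q"
      using one_minus_cos_pos[OF R, of \<theta>] q_pos by (simp_all add: d_def s_def)
    have n2: "n^2 = 2 * s - k - s^2"
      unfolding n_def s_def k_def power_mult_distrib sin_squared_eq
      by (simp add: power2_eq_square algebra_simps)
    have sum: "d^2 + n^2 = 2 * s * (1 + q)"
      unfolding n2 d(2) by (simp add: q_sq power2_sum algebra_simps)
    have "((\<lambda>\<theta>. R * sin \<theta> / (1 + q - R * cos \<theta>)) has_real_derivative
        (R * cos \<theta> * d - n * (R * sin \<theta>)) / d^2) (at \<theta>)"
      using d(1) unfolding d_def n_def
      by (auto intro!: derivative_eq_intros simp: power2_eq_square)
    also have "R * cos \<theta> * d - n * (R * sin \<theta>) = (1 - s) * d - n^2"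
      by (simp add: s_def n_def power2_eq_square)
    finally have "((\<lambda>\<theta>. R * sin \<theta> / (1 + q - R * cos \<theta>)) has_real_derivative
        ((1 - s) * d - n^2) / d^2) (at \<theta>)" .
    from DERIV_chain2[OF DERIV_arctan this]
    have "((\<lambda>\<theta>. arctan (R * sin \<theta> / (1 + q - R * cos \<theta>))) has_real_derivative
        inverse (1 + (n / d)^2) * (((1 - s) * d - n^2) / d^2)) (at \<theta>)"
      by (simp only: n_def d_def)
    also have "inverse (1 + (n / d)^2) * (((1 - s) * d - n^2) / d^2) = ((1 - s) * d - n^2) / (d^2 + n^2)"
    proof -
      have "d^2 + n^2 > 0" using d(1) by (simp add: add_pos_nonneg)
      moreover have "1 + (n / d)^2 = (d^2 + n^2) / d^2"
        using d(1) by (simp add: power_divide add_divide_distrib)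
      ultimately show ?thesis using d(1) by simp
    qed
    also have "(1 - s) * d - n^2 = (1 + q) * (q - s)"
      unfolding n2 d(2) by (simp add: q_sq[symmetric] power2_eq_square algebra_simps)
    also have "(1 + q) * (q - s) / (d^2 + n^2) = (q - s) / (2 * s)"
      unfolding sum using q_pos s by (simp add: divide_simps)
    finally have "((\<lambda>\<theta>. (\<theta> + 2 * arctan (R * sin \<theta> / (1 + q - R * cos \<theta>))) / q) has_real_derivative
        (1 + 2 * ((q - s) / (2 * s))) / q) (at \<theta>)"
      by (intro DERIV_cdivide DERIV_add DERIV_ident DERIV_cmult)
    also have "(1 + 2 * ((q - s) / (2 * s))) / q = 1 / s"
      using s q_pos by (simp add: field_simps)
    finally show ?thesis by (simp only: s_def)
  qed
  from has_integral_half_turn[OF der] show ?thesis by simp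
qed

text \<open>The derivatives of \<open>sin \<theta> / s\<close> and \<open>sin \<theta> / s^2\<close> are combinations of \<open>1 / s\<close>, \<open>1 / s^2\<close> and
  \<open>1 / s^3\<close>. Their integrals vanish because \<open>sin\<close> does at both ends, which reduces the higher powers
  to the first one. The factors \<open>k\<close> and \<open>k^2\<close> keep the values free of denominators other than \<open>q\<close>.\<close>
lemma half_turn_inverse_powers:
  shows "((\<lambda>\<theta>. k / (1 - R * cos \<theta>)^2) has_integral pi / q) {0..pi}"
    and "((\<lambda>\<theta>. k^2 / (1 - R * cos \<theta>)^3) has_integral pi * (3 - k) / (2 * q)) {0..pi}"
proof -
  define s where "s = (\<lambda>\<theta>. 1 - R * cos \<theta>)"
  have s: "s \<theta> > 0" for \<theta> using one_minus_cos_pos[OF R] by (simp add: s_def)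
  have sin2: "(R * sin \<theta>)^2 = 2 * s \<theta> - k - s \<theta>^2" for \<theta>
    unfolding s_def k_def power_mult_distrib sin_squared_eq
    by (simp add: power2_eq_square algebra_simps)
  have rc: "R * cos \<theta> = 1 - s \<theta>" for \<theta> by (simp add: s_def)
  have ds: "(s has_real_derivative R * sin \<theta>) (at \<theta>)" for \<theta>
    unfolding s_def by (auto intro!: derivative_eq_intros)
  have dn: "((\<lambda>\<theta>. R * sin \<theta>) has_real_derivative 1 - s \<theta>) (at \<theta>)" for \<theta>
    unfolding rc[symmetric] by (auto intro!: derivative_eq_intros)
  have "((\<lambda>\<theta>. R * sin \<theta> / s \<theta>) has_real_derivative k / s \<theta>^2 - 1 / s \<theta>) (at \<theta>)" for \<theta>
  proof -
    have "((\<lambda>\<theta>. R * sin \<theta> / s \<theta>) has_real_derivative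
        ((1 - s \<theta>) * s \<theta> - (R * sin \<theta>)^2) / s \<theta>^2) (at \<theta>)"
      using DERIV_divide[OF dn ds] s[of \<theta>] by (simp add: power2_eq_square)
    also have "((1 - s \<theta>) * s \<theta> - (R * sin \<theta>)^2) / s \<theta>^2 = k / s \<theta>^2 - 1 / s \<theta>"
      unfolding sin2 using s[of \<theta>] by (simp add: field_simps power2_eq_square)
    finally show ?thesis .
  qed
  from has_integral_half_turn[OF this]
  have "((\<lambda>\<theta>. k / s \<theta>^2 - 1 / s \<theta>) has_integral 0) {0..pi}" by simp
  have I1: "((\<lambda>\<theta>. 1 / s \<theta>) has_integral pi / q) {0..pi}"
    unfolding s_def by (rule half_turn_inverse)
  from has_integral_add[OF \<open>((\<lambda>\<theta>. k / s \<theta>^2 - 1 / s \<theta>) has_integral 0) {0..pi}\<close> I1]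
  have I2: "((\<lambda>\<theta>. k / s \<theta>^2) has_integral pi / q) {0..pi}" by (simp add: s_def)
  then show "((\<lambda>\<theta>. k / (1 - R * cos \<theta>)^2) has_integral pi / q) {0..pi}" by (simp add: s_def)
  have "((\<lambda>\<theta>. R * sin \<theta> / s \<theta>^2) has_real_derivative
      2 * k / s \<theta>^3 - 3 / s \<theta>^2 + 1 / s \<theta>) (at \<theta>)" for \<theta>
  proof -
    have "((\<lambda>\<theta>. R * sin \<theta> / s \<theta>^2) has_real_derivative
        ((1 - s \<theta>) * s \<theta>^2 - 2 * (R * sin \<theta>)^2 * s \<theta>) / (s \<theta>^2 * s \<theta>^2)) (at \<theta>)"
      using DERIV_divide[OF dn DERIV_power[OF ds, of 2]] s[of \<theta>]
      by (simp add: power2_eq_square algebra_simps)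
    also have "((1 - s \<theta>) * s \<theta>^2 - 2 * (R * sin \<theta>)^2 * s \<theta>) / (s \<theta>^2 * s \<theta>^2) =
        2 * k / s \<theta>^3 - 3 / s \<theta>^2 + 1 / s \<theta>"
      unfolding sin2 using s[of \<theta>] by (simp add: divide_simps) (simp add: algebra_simps eval_nat_numeral)
    finally show ?thesis .
  qed
  from has_integral_half_turn[OF this]
  have "((\<lambda>\<theta>. 2 * k / s \<theta>^3 - 3 / s \<theta>^2 + 1 / s \<theta>) has_integral 0) {0..pi}" by simp
  from has_integral_mult_right[OF this, of "k / 2"]
  have "((\<lambda>\<theta>. k / 2 * (2 * k / s \<theta>^3 - 3 / s \<theta>^2 + 1 / s \<theta>)) has_integral 0) {0..pi}" by simp
  from has_integral_add[OF has_integral_add[OF this has_integral_mult_right[OF I2, of "3 / 2"]]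
      has_integral_mult_right[OF I1, of "- k / 2"]]
  have "((\<lambda>\<theta>. k^2 / s \<theta>^3) has_integral 3 / 2 * (pi / q) + - k / 2 * (pi / q)) {0..pi}"
    by (rule has_integral_eq_rhs[OF has_integral_eq[rotated]])
       (simp_all add: algebra_simps power2_eq_square)
  also have "3 / 2 * (pi / q) + - k / 2 * (pi / q) = pi * (3 - k) / (2 * q)"
    using q_pos by (simp add: field_simps)
  finally show "((\<lambda>\<theta>. k^2 / (1 - R * cos \<theta>)^3) has_integral pi * (3 - k) / (2 * q)) {0..pi}"
    by (simp add: s_def)
qed

text \<open>Substitution \<open>s = 1 - R cos \<theta>\<close>, \<open>ds = R sin \<theta> d\<theta>\<close>: a factor \<open>sin \<theta>\<close> makes the integral one in
  \<open>s\<close> over \<open>[1 - R, 1 + R]\<close>.\<close>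
lemma half_turn_odd:
  assumes "\<And>s. 0 < s \<Longrightarrow> (f has_real_derivative f' s) (at s)"
  shows "((\<lambda>\<theta>. R * sin \<theta> * f' (1 - R * cos \<theta>)) has_integral f (1 + R) - f (1 - R)) {0..pi}"
proof -
  have "((\<lambda>\<theta>. f (1 - R * cos \<theta>)) has_real_derivative
      f' (1 - R * cos \<theta>) * (R * sin \<theta>)) (at \<theta>)" for \<theta>
    using one_minus_cos_pos[OF R]
    by (intro DERIV_chain2[OF assms]) (auto intro!: derivative_eq_intros)
  from has_integral_half_turn[OF this] show ?thesis by (simp add: mult.commute)
qed

lemma half_turn_odd_powers:
  shows "((\<lambda>\<theta>. R * sin \<theta>) has_integral 2 * R) {0..pi}"
    and "((\<lambda>\<theta>. R * sin \<theta> * (1 - R * cos \<theta>)) has_integral 2 * R) {0..pi}"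
    and "((\<lambda>\<theta>. R * sin \<theta> / (1 - R * cos \<theta>)) has_integral ln ((1 + R) / (1 - R))) {0..pi}"
    and "((\<lambda>\<theta>. R * sin \<theta> * k / (1 - R * cos \<theta>)^2) has_integral 2 * R) {0..pi}"
    and "((\<lambda>\<theta>. R * sin \<theta> * k^3 / (1 - R * cos \<theta>)^4) has_integral 2 * R * (4 - k) / 3) {0..pi}"
proof -
  have k: "k = (1 + R) * (1 - R)" by (simp add: k_def power2_eq_square algebra_simps)
  show "((\<lambda>\<theta>. R * sin \<theta>) has_integral 2 * R) {0..pi}"
    using half_turn_odd[of "\<lambda>s. s" "\<lambda>_. 1"] by simp
  show "((\<lambda>\<theta>. R * sin \<theta> * (1 - R * cos \<theta>)) has_integral 2 * R) {0..pi}"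
  proof -
    have "((\<lambda>s. s^2 / 2) has_real_derivative s) (at s)" for s :: real
      by (auto intro!: derivative_eq_intros)
    from half_turn_odd[OF this] show ?thesis by (simp add: power2_eq_square field_simps)
  qed
  show "((\<lambda>\<theta>. R * sin \<theta> / (1 - R * cos \<theta>)) has_integral ln ((1 + R) / (1 - R))) {0..pi}"
  proof -
    have "(ln has_real_derivative 1 / s) (at s)" if "0 < s" for s :: real
      using that by (auto intro!: derivative_eq_intros)
    from half_turn_odd[OF this] show ?thesis using R by (simp add: ln_div)
  qed
  show "((\<lambda>\<theta>. R * sin \<theta> * k / (1 - R * cos \<theta>)^2) has_integral 2 * R) {0..pi}"
  proof -
    have k1: "k / (1 + R) = 1 - R" "k / (1 - R) = 1 + R" using R unfolding k by simp_all
    have "((\<lambda>s. - k / s) has_real_derivative k / s^2) (at s)" if "0 < s" for s :: real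
      using that by (auto intro!: derivative_eq_intros simp: power2_eq_square)
    from half_turn_odd[OF this]
    have "((\<lambda>\<theta>. R * sin \<theta> * (k / (1 - R * cos \<theta>)^2)) has_integral
        - k / (1 + R) - - k / (1 - R)) {0..pi}" .
    moreover have "- k / (1 + R) - - k / (1 - R) = 2 * R"
      by (simp add: k1)
    ultimately show ?thesis by simp
  qed
  show "((\<lambda>\<theta>. R * sin \<theta> * k^3 / (1 - R * cos \<theta>)^4) has_integral 2 * R * (4 - k) / 3) {0..pi}"
  proof -
    have "((\<lambda>s. - (k^3) / 3 / s^3) has_real_derivative k^3 / s^4) (at s)" if "0 < s" for s :: real
      using that by (auto intro!: derivative_eq_intros simp: field_simps eval_nat_numeral)
    note integral = half_turn_odd[OF this]
    have "- (k^3) / 3 / (1 + R)^3 - - (k^3) / 3 / (1 - R)^3 = ((1 + R)^3 - (1 - R)^3) / 3"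
      using R unfolding k power_mult_distrib by simp
    also have "(1 + R)^3 - (1 - R)^3 = 2 * R * (4 - k)"
      by (simp add: k_def power2_eq_square power3_eq_cube algebra_simps)
    finally show ?thesis
      using integral by (simp only: times_divide_eq_right)
  qed
qed

end

section \<open>The first-order coefficient in polar coordinates\<close>

lemma to_uv_has_derivative:
  assumes "32 * x^2 - 24 * y + 9 \<noteq> (0::real)"
  defines "D \<equiv> 32 * x^2 - 24 * y + 9"
  shows "(to_uv has_derivative (\<lambda>(a, b). (3 * a / D - 3 * x * (64 * x * a - 24 * b) / D^2,
    - 9 * (64 * x * a - 24 * b) / (8 * D^2)))) (at (x, y))"
proof -
  have D: "D \<noteq> 0" using assms(1) by (simp add: D_def)
  have dD: "((\<lambda>p. 32 * fst p^2 - 24 * snd p + 9) has_derivative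
      (\<lambda>p. 64 * x * fst p - 24 * snd p)) (at (x, y))"
    by (auto intro!: derivative_eq_intros)
  have n1: "((\<lambda>p. 3 * fst p) has_derivative (\<lambda>p. 3 * fst p)) (at (x, y))"
    by (auto intro!: derivative_eq_intros)
  have n2: "((\<lambda>p. - 4 * fst p^2 + 3 * snd p) has_derivative (\<lambda>p. - 8 * x * fst p + 3 * snd p)) (at (x, y))"
    by (auto intro!: derivative_eq_intros)
  have "((\<lambda>p. (3 * fst p / (32 * fst p^2 - 24 * snd p + 9),
      (- 4 * fst p^2 + 3 * snd p) / (32 * fst p^2 - 24 * snd p + 9))) has_derivative
    (\<lambda>(a, b). (3 * a / D - 3 * x * (64 * x * a - 24 * b) / D^2,
    - 9 * (64 * x * a - 24 * b) / (8 * D^2)))) (at (x, y))"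
  proof (rule has_derivative_eq_rhs[OF has_derivative_Pair[OF has_derivative_divide'[OF n1 dD]
        has_derivative_divide'[OF n2 dD]]])
    have v: "- 4 * x^2 + 3 * y = (9 - D) / 8" by (simp add: D_def)
    show "(\<lambda>h. ((3 * fst h * (32 * fst (x, y)^2 - 24 * snd (x, y) + 9) -
         3 * fst (x, y) * (64 * x * fst h - 24 * snd h)) /
        ((32 * fst (x, y)^2 - 24 * snd (x, y) + 9) * (32 * fst (x, y)^2 - 24 * snd (x, y) + 9)),
        ((- 8 * x * fst h + 3 * snd h) * (32 * fst (x, y)^2 - 24 * snd (x, y) + 9) -
         (- 4 * fst (x, y)^2 + 3 * snd (x, y)) * (64 * x * fst h - 24 * snd h)) /
        ((32 * fst (x, y)^2 - 24 * snd (x, y) + 9) * (32 * fst (x, y)^2 - 24 * snd (x, y) + 9)))) =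
      (\<lambda>(a, b). (3 * a / D - 3 * x * (64 * x * a - 24 * b) / D^2,
        - 9 * (64 * x * a - 24 * b) / (8 * D^2)))"
      unfolding fst_conv snd_conv D_def[symmetric] v
      using D by (auto simp: fun_eq_iff field_simps power2_eq_square)
  qed (use D in \<open>simp_all add: D_def\<close>)
  moreover have "to_uv = (\<lambda>p. (3 * fst p / (32 * fst p^2 - 24 * snd p + 9),
      (- 4 * fst p^2 + 3 * snd p) / (32 * fst p^2 - 24 * snd p + 9)))"
    by (auto simp: to_uv_def)
  ultimately show ?thesis by simp
qed

text \<open>On the circle of radius \<open>r = R / 8\<close> in the linearising plane, \<open>circ_s\<close> is the denominator
  \<open>8 v + 1\<close> of \<^const>\<open>from_uv\<close>, and \<open>(circ_x, circ_y)\<close> is the corresponding point of the original plane;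
  see \<open>from_uv_polar_point\<close>.\<close>
definition circ_s :: "real \<Rightarrow> real \<Rightarrow> real" where "circ_s R \<theta> = 1 - R * cos \<theta>"
definition circ_x :: "real \<Rightarrow> real \<Rightarrow> real" where "circ_x R \<theta> = 3 / 8 * (R * sin \<theta>) / circ_s R \<theta>"
definition circ_y :: "real \<Rightarrow> real \<Rightarrow> real" where
  "circ_y R \<theta> = 3 / 16 * (1 - (1 - R^2) / circ_s R \<theta>^2)"

context
  fixes r \<theta> k s x y :: real
  assumes r: "0 < r" "r < 1 / 8"
  defines "k \<equiv> 1 - (8 * r)^2" and "s \<equiv> circ_s (8 * r) \<theta>"
    and "x \<equiv> circ_x (8 * r) \<theta>" and "y \<equiv> circ_y (8 * r) \<theta>"
begin

private lemma s_pos: "s > 0"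
  using one_minus_cos_pos[of "8 * r" \<theta>] r by (simp add: s_def circ_s_def)

private lemma trig: "8 * r * cos \<theta> = 1 - s" "8 * r * sin \<theta> = 8 / 3 * s * x"
    "(8 * r * sin \<theta>)^2 = 2 * s - k - s^2" "y = 3 / 16 * (1 - k / s^2)"
proof -
  show "8 * r * cos \<theta> = 1 - s" by (simp add: s_def circ_s_def)
  show "8 * r * sin \<theta> = 8 / 3 * s * x" using s_pos by (simp add: x_def circ_x_def flip: s_def)
  show "(8 * r * sin \<theta>)^2 = 2 * s - k - s^2"
    unfolding s_def circ_s_def k_def power_mult_distrib[of "8 * r"] sin_squared_eq
    by (simp add: power2_eq_square algebra_simps)
  show "y = 3 / 16 * (1 - k / s^2)" by (simp add: y_def circ_y_def k_def s_def)
qed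

private lemma x_sq: "x^2 = 9 / 64 * (2 * s - k - s^2) / s^2"
proof -
  have "(8 / 3 * s * x)^2 = 2 * s - k - s^2" using trig(3) unfolding trig(2) .
  then have "64 / 9 * (s^2 * x^2) = 2 * s - k - s^2"
    by (simp add: power_mult_distrib power_divide)
  then show ?thesis using s_pos by (simp add: field_simps)
qed

text \<open>Since \<open>8 u\<close> and \<open>8 v\<close> are \<open>8 r sin \<theta>\<close> and \<open>s - 1\<close>, the numerator \<open>4 u^2 + 8 v^2 + v\<close> collapses to
  \<open>(s^2 - k) / 16\<close>.\<close>
lemma from_uv_polar_point: "from_uv (polar_point \<theta> r) = (x, y)"
proof -
  have v: "8 * (- r * cos \<theta>) + 1 = s" using trig(1) by simp
  have "3 * (r * sin \<theta>) / s = x" using trig(2) s_pos by (simp add: field_simps)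
  moreover have "3 * (4 * (r * sin \<theta>)^2 + 8 * (- r * cos \<theta>)^2 + - r * cos \<theta>) / s^2 = y"
  proof -
    have "(4 * (r * sin \<theta>)^2 + 8 * (- r * cos \<theta>)^2 + - r * cos \<theta>) * 16 =
        (8 * r * sin \<theta>)^2 + 2 * (8 * r * cos \<theta>)^2 - 2 * (8 * r * cos \<theta>)"
      by (simp add: power_mult_distrib)
    also have "\<dots> = s^2 - k"
      unfolding trig(1,3) by (simp add: power2_eq_square algebra_simps)
    finally have e: "4 * (r * sin \<theta>)^2 + 8 * (- r * cos \<theta>)^2 + - r * cos \<theta> = (s^2 - k) / 16"
      by (intro eq_divide_imp) simp_all
    show ?thesis unfolding e trig(4) using s_pos by (simp add: field_simps)
  qed
  ultimately show ?thesis unfolding from_uv_def polar_point_def by (simp add: v[simplified])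
qed

text \<open>On the circle, the denominator \<open>32 x^2 - 24 y + 9\<close> of \<^const>\<open>to_uv\<close> equals \<open>9 / s\<close>.\<close>
lemma uv_field_polar_point:
  "uv_field Z (polar_point \<theta> r) =
    (s * fst (Z (x, y)) / 3 - x * s^2 / 27 * (64 * x * fst (Z (x, y)) - 24 * snd (Z (x, y))),
     - (s^2) / 72 * (64 * x * fst (Z (x, y)) - 24 * snd (Z (x, y))))"
proof -
  have D: "32 * x^2 - 24 * y + 9 = 9 / s"
    unfolding x_sq trig(4) using s_pos by (simp add: field_simps power2_eq_square)
  then have "32 * x^2 - 24 * y + 9 \<noteq> 0" using s_pos by simp
  from frechet_derivative_at[OF to_uv_has_derivative[OF this], symmetric]
  show ?thesis
    unfolding uv_field_def from_uv_polar_point D using s_pos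
    by (simp add: case_prod_beta field_simps power2_eq_square)
qed

lemma radial_speed_polar:
  "radial_speed (uv_field Z) \<theta> r =
    (8 / 3 * k * s * x * fst (Z (x, y)) + s * (s - k) * snd (Z (x, y))) / (3 * (8 * r))"
proof -
  define P where "P = fst (Z (x, y))"
  define Q where "Q = snd (Z (x, y))"
  have "8 * r * radial_speed (uv_field Z) \<theta> r =
      (s * P / 3 - x * s^2 / 27 * (64 * x * P - 24 * Q)) * (8 * r * sin \<theta>) +
      s^2 / 72 * (64 * x * P - 24 * Q) * (8 * r * cos \<theta>)"
    unfolding radial_speed_def uv_field_polar_point P_def[symmetric] Q_def[symmetric]
    by (simp add: algebra_simps)
  also have "\<dots> = x * P * (8 / 9 * s^2 - 512 / 81 * s^3 * x^2 + 8 / 9 * s^2 * (1 - s)) +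
      Q * (64 / 27 * s^3 * x^2 - s^2 * (1 - s) / 3)"
    unfolding trig(1,2) by (simp add: power2_eq_square power3_eq_cube field_simps)
  also have "8 / 9 * s^2 - 512 / 81 * s^3 * x^2 + 8 / 9 * s^2 * (1 - s) = 8 / 9 * k * s"
    unfolding x_sq using s_pos by (simp add: field_simps power2_eq_square power3_eq_cube)
  also have "64 / 27 * s^3 * x^2 - s^2 * (1 - s) / 3 = s * (s - k) / 3"
    unfolding x_sq using s_pos by (simp add: field_simps power2_eq_square power3_eq_cube)
  finally show ?thesis
    using r unfolding P_def[symmetric] Q_def[symmetric] by (simp add: field_simps)
qed

text \<open>Linearity in the value of the field makes the angular speed of the perturbed field a polynomial in
  \<open>\<epsilon>\<close>; the first-order coefficient sees only its constant term, the speed of the center.\<close>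
lemma angular_speed_polar:
  "\<exists>a b. \<forall>Z. angular_speed (uv_field Z) \<theta> r = a * fst (Z (x, y)) + b * snd (Z (x, y))"
  unfolding angular_speed_def uv_field_polar_point
  by (rule exI[of _ "((s / 3 - 64 * x * x * s^2 / 27) * cos \<theta> - 64 * x * s^2 / 72 * sin \<theta>) / r"],
      rule exI[of _ "(24 * x * s^2 / 27 * cos \<theta> + 24 * s^2 / 72 * sin \<theta>) / r"])
     (use r in \<open>simp add: field_simps\<close>)

private lemma center3_polar:
  "fst (center3 (x, y)) = 3 / 8 * (k - s) / s^2" "snd (center3 (x, y)) = x * (k / s^2)"
proof -
  have "- y - 4 / 3 * x^2 = 3 / 8 * (k - s) / s^2"
    unfolding x_sq trig(4) using s_pos by (simp add: field_simps power2_eq_square)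
  then show "fst (center3 (x, y)) = 3 / 8 * (k - s) / s^2" by (simp add: center3_def)
  have "x - 16 / 3 * x * y = x * (1 - 16 / 3 * y)" by (simp add: algebra_simps)
  also have "1 - 16 / 3 * y = k / s^2" unfolding trig(4) by (simp add: field_simps)
  finally show "snd (center3 (x, y)) = x * (k / s^2)" by (simp add: center3_def)
qed

lemma radial_speed_center: "radial_speed (uv_field center3) \<theta> r = 0"
proof -
  have "8 / 3 * k * s * x * (3 / 8 * (k - s) / s^2) + s * (s - k) * (x * (k / s^2)) = 0"
    using s_pos by (simp add: field_simps)
  then show ?thesis unfolding radial_speed_polar center3_polar by simp
qed

lemma angular_speed_center: "angular_speed (uv_field center3) \<theta> r = 1"
proof -
  let ?\<delta> = "64 * x * fst (center3 (x, y)) - 24 * snd (center3 (x, y))"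
  have d: "?\<delta> = x * (- 24 / s)"
    unfolding center3_polar using s_pos by (simp add: field_simps power2_eq_square)
  have "8 * r * angular_speed (uv_field center3) \<theta> r * r =
      (s * fst (center3 (x, y)) / 3 - x * s^2 / 27 * ?\<delta>) * (8 * r * cos \<theta>) +
      (- (s^2) / 72 * ?\<delta>) * (8 * r * sin \<theta>)"
    unfolding angular_speed_def uv_field_polar_point using r
    by (simp add: field_simps)
  also have "\<dots> = ((k - s) / (8 * s) + 8 / 9 * s * x^2) * (1 - s) + s / 3 * x * (8 / 3 * s * x)"
    unfolding d unfolding center3_polar(1) trig(1,2) using s_pos r by (simp add: field_simps power2_eq_square)
  also have "\<dots> = (1 - s)^2 / 8 + (2 * s - k - s^2) / 8"
  proof -
    have "8 / 9 * s * x^2 = (2 * s - k - s^2) / (8 * s)"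
      unfolding x_sq using s_pos by (simp add: field_simps power2_eq_square)
    moreover have "s / 3 * x * (8 / 3 * s * x) = (2 * s - k - s^2) / 8"
      using x_sq s_pos by (simp add: field_simps power2_eq_square)
    ultimately show ?thesis using s_pos by (simp add: field_simps power2_eq_square)
  qed
  also have "\<dots> = 8 * r^2" by (simp add: k_def power2_eq_square field_simps)
  finally show ?thesis using r by (simp add: power2_eq_square)
qed

text \<open>The radial speed has no term of order \<open>0\<close> in \<open>\<epsilon>\<close> and the angular speed starts with \<open>1\<close>, so the
  first-order coefficient of their quotient is the radial speed of the first-order perturbation. The sign
  of \<open>x\<close>, which selects the branch of the field, is the sign of \<open>sin \<theta>\<close>.\<close>
lemma F1_Z3:
  fixes X1p X2p X1m X2m :: plane_field
  assumes "sin \<theta> \<noteq> 0"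
  defines "X \<equiv> if sin \<theta> > 0 then X1p (x, y) else X1m (x, y)"
  shows "F1 (Z3 X1p X2p X1m X2m) \<theta> r = 
    (8 / 3 * k * s * x * fst X + s * (s - k) * snd X) / (3 * (8 * r))"
proof -
  have "x > 0 \<longleftrightarrow> sin \<theta> > 0"
    using r s_pos by (simp add: x_def circ_x_def zero_less_divide_iff zero_less_mult_iff flip: s_def)
  define X' where "X' = (if sin \<theta> > 0 then X2p (x, y) else X2m (x, y))"
  have Z: "Z3 X1p X2p X1m X2m \<epsilon> (x, y) = center3 (x, y) + \<epsilon> *\<^sub>R X + \<epsilon>^2 *\<^sub>R X'" for \<epsilon>
    using \<open>x > 0 \<longleftrightarrow> _\<close> by (simp add: Z3_def X_def X'_def)
  define \<rho> where "\<rho> = (\<lambda>v. (8 / 3 * k * s * x * fst v + s * (s - k) * snd v) / (3 * (8 * r)))"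
  have rad: "radial_speed (uv_field Z) \<theta> r = \<rho> (Z (x, y))" for Z
    by (simp only: radial_speed_polar \<rho>_def)
  obtain a b where ang: "angular_speed (uv_field Z) \<theta> r = a * fst (Z (x, y)) + b * snd (Z (x, y))" for Z
    using angular_speed_polar by blast
  define \<alpha> where "\<alpha> = (\<lambda>v :: real \<times> real. a * fst v + b * snd v)"
  have \<rho>_lin: "\<rho> (u + c *\<^sub>R v + d *\<^sub>R w) = \<rho> u + c * \<rho> v + d * \<rho> w" for u v w c d
    unfolding \<rho>_def divide_inverse by (simp add: algebra_simps)
  have "\<rho> (center3 (x, y)) = 0" using radial_speed_center rad by simp
  then have rZ: "radial_speed (uv_field (Z3 X1p X2p X1m X2m \<epsilon>)) \<theta> r = \<epsilon> * \<rho> X + \<epsilon>^2 * \<rho> X'" for \<epsilon>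
    unfolding rad Z \<rho>_lin by simp
  have "\<alpha> (center3 (x, y)) = 1" using angular_speed_center ang by (simp add: \<alpha>_def)
  then have aZ: "angular_speed (uv_field (Z3 X1p X2p X1m X2m \<epsilon>)) \<theta> r = 1 + \<epsilon> * \<alpha> X + \<epsilon>^2 * \<alpha> X'" for \<epsilon>
    unfolding ang Z \<alpha>_def by (simp add: algebra_simps)
  have "((\<lambda>\<epsilon>. (\<epsilon> * \<rho> X + \<epsilon>^2 * \<rho> X') / (1 + \<epsilon> * \<alpha> X + \<epsilon>^2 * \<alpha> X')) has_real_derivative \<rho> X) (at 0)"
    by (auto intro!: derivative_eq_intros)
  then show ?thesis
    unfolding F1_def dr_dtheta_def rZ aZ by (simp add: DERIV_imp_deriv \<rho>_def)
qed

end

section \<open>Evaluation of the averaged function\<close>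

definition half_turn_integrand :: "plane_field \<Rightarrow> real \<Rightarrow> real \<Rightarrow> real" where
  "half_turn_integrand X R \<theta> =
     (let s = circ_s R \<theta>; x = circ_x R \<theta>; k = 1 - R^2; V = X (x, circ_y R \<theta>) in
      8 / 3 * k * s * x * fst V + s * (s - k) * snd V)"

text \<open>The reflection \<open>x \<mapsto> - x\<close> becomes \<open>u \<mapsto> - u\<close> in the linearising plane, that is
  \<open>\<theta> \<mapsto> - \<theta>\<close>, and it preserves radial speeds.\<close>
definition mirror :: "plane_field \<Rightarrow> plane_field" where
  "mirror X = (\<lambda>(x, y). (- fst (X (- x, y)), snd (X (- x, y))))"

lemma F1_upper_half:
  assumes "0 < r" "r < 1 / 8" "0 < \<theta>" "\<theta> < pi"
  shows "F1 (Z3 X1p X2p X1m X2m) \<theta> r = half_turn_integrand X1p (8 * r) \<theta> / (24 * r)"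
  using F1_Z3[OF assms(1,2), of \<theta> X1p X2p X1m X2m] sin_gt_zero[OF assms(3,4)]
  by (simp add: half_turn_integrand_def Let_def)

lemma F1_lower_half:
  assumes "0 < r" "r < 1 / 8" "0 < \<theta>" "\<theta> < pi"
  shows "F1 (Z3 X1p X2p X1m X2m) (- \<theta>) r = half_turn_integrand (mirror X1m) (8 * r) \<theta> / (24 * r)"
proof -
  have "circ_s (8 * r) (- \<theta>) = circ_s (8 * r) \<theta>" "circ_x (8 * r) (- \<theta>) = - circ_x (8 * r) \<theta>"
      "circ_y (8 * r) (- \<theta>) = circ_y (8 * r) \<theta>"
    by (simp_all add: circ_s_def circ_x_def circ_y_def)
  then show ?thesis
    using F1_Z3[OF assms(1,2), of "- \<theta>" X1p X2p X1m X2m] sin_gt_zero[OF assms(3,4)]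
    by (simp add: half_turn_integrand_def mirror_def Let_def)
qed

text \<open>At \<open>\<theta> = 0\<close> and \<open>\<theta> = \<pi>\<close> the integrand depends on the choice made for the field on the line
  \<open>x = 0\<close>; these two angles form a null set.\<close>
lemma averaged1_half_turns:
  assumes r: "0 < r" "r < 1 / 8"
    and plus: "(half_turn_integrand X1p (8 * r) has_integral i) {0..pi}"
    and minus: "(half_turn_integrand (mirror X1m) (8 * r) has_integral j) {0..pi}"
  shows "averaged1 (Z3 X1p X2p X1m X2m) r = (i + j) / (24 * r)"
proof -
  let ?F = "\<lambda>\<theta>. F1 (Z3 X1p X2p X1m X2m) \<theta> r"
  have up: "(?F has_integral i / (24 * r)) {0..pi}"
  proof (rule has_integral_spike_interior[of _ _ 0 pi, unfolded box_real])
    show "((\<lambda>\<theta>. half_turn_integrand X1p (8 * r) \<theta> / (24 * r)) has_integral i / (24 * r)) {0..pi}"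
      using plus by (rule has_integral_divide)
  qed (use F1_upper_half[OF r] in simp)
  have "((\<lambda>\<theta>. ?F (- \<theta>)) has_integral j / (24 * r)) {0..pi}"
  proof (rule has_integral_spike_interior[of _ _ 0 pi, unfolded box_real])
    show "((\<lambda>\<theta>. half_turn_integrand (mirror X1m) (8 * r) \<theta> / (24 * r)) has_integral j / (24 * r)) {0..pi}"
      using minus by (rule has_integral_divide)
  qed (use F1_lower_half[OF r] in simp)
  then have "((\<lambda>\<theta>. ?F (- \<theta>)) has_integral j / (24 * r)) {- 0..- (- pi)}"
    by (simp only: minus_zero minus_minus)
  then have "(?F has_integral j / (24 * r)) {-pi..0}"
    by (rule has_integral_reflect_real[where f = ?F, THEN iffD1])
  from has_integral_combine[OF _ _ this up]
  have "(?F has_integral j / (24 * r) + i / (24 * r)) {-pi..pi}" by simp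
  then show ?thesis
    by (simp add: averaged1_def integral_unique add_divide_distrib)
qed

definition quad :: "real \<Rightarrow> real \<Rightarrow> real \<Rightarrow> real \<Rightarrow> real \<Rightarrow> real \<Rightarrow> real \<Rightarrow> real \<Rightarrow> real" where
  "quad c00 c10 c01 c20 c11 c02 x y = c00 + c10 * x + c01 * y + c20 * x^2 + c11 * x * y + c02 * y^2"

lemma poly2_deg_le_2_iff:
  "poly2_deg_le 2 P \<longleftrightarrow> (\<exists>c00 c10 c01 c20 c11 c02. \<forall>x y. P (x, y) = quad c00 c10 c01 c20 c11 c02 x y)"
proof
  assume "poly2_deg_le 2 P"
  then obtain c where "\<forall>x y. P (x, y) = (\<Sum>i\<le>2. \<Sum>j\<le>2 - i. c i j * x ^ i * y ^ j)"
    unfolding poly2_deg_le_def by blast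
  then have "\<forall>x y. P (x, y) = quad (c 0 0) (c 1 0) (c 0 1) (c 2 0) (c 1 1) (c 0 2) x y"
    by (simp add: quad_def numeral_2_eq_2 algebra_simps)
  then show "\<exists>c00 c10 c01 c20 c11 c02. \<forall>x y. P (x, y) = quad c00 c10 c01 c20 c11 c02 x y" by blast
next
  assume "\<exists>c00 c10 c01 c20 c11 c02. \<forall>x y. P (x, y) = quad c00 c10 c01 c20 c11 c02 x y"
  then obtain c00 c10 c01 c20 c11 c02 where P: "P (x, y) = quad c00 c10 c01 c20 c11 c02 x y" for x y
    by blast
  let ?c = "\<lambda>i j. [[c00, c01, c02], [c10, c11], [c20]] ! i ! j"
  have "\<forall>x y. P (x, y) = (\<Sum>i\<le>2. \<Sum>j\<le>2 - i. ?c i j * x ^ i * y ^ j)"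
    by (simp add: P quad_def numeral_2_eq_2 algebra_simps)
  then show "poly2_deg_le 2 P" unfolding poly2_deg_le_def by (intro exI[of _ ?c])
qed

text \<open>Linearity, applied to exactly those powers of \<open>s = 1 - R cos \<theta>\<close> that quadratic perturbations
  produce.\<close>
lemma laurent_half_turn:
  assumes R: "0 < R" "R < 1"
  defines "k \<equiv> 1 - R^2" and "q \<equiv> sqrt (1 - R^2)" and "L \<equiv> ln ((1 + R) / (1 - R))"
  shows "((\<lambda>\<theta>. e2 * (1 - R * cos \<theta>)^2 + e1 * (1 - R * cos \<theta>) + e0 + f1 * (1 / (1 - R * cos \<theta>)) +
      f2 * (k / (1 - R * cos \<theta>)^2) + f3 * (k^2 / (1 - R * cos \<theta>)^3) +
      (g1 * (R * sin \<theta> * (1 - R * cos \<theta>)) + g0 * (R * sin \<theta>) +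
       h1 * (R * sin \<theta> / (1 - R * cos \<theta>)) + h2 * (R * sin \<theta> * k / (1 - R * cos \<theta>)^2) +
       h4 * (R * sin \<theta> * k^3 / (1 - R * cos \<theta>)^4))) has_integral
    e2 * (pi * (3 - k) / 2) + e1 * pi + e0 * pi + f1 * (pi / q) + f2 * (pi / q) +
      f3 * (pi * (3 - k) / (2 * q)) +
    (g1 * (2 * R) + g0 * (2 * R) + h1 * L + h2 * (2 * R) + h4 * (2 * R * (4 - k) / 3))) {0..pi}"
proof -
  note R' = R half_turn_nonneg_powers[OF R] half_turn_inverse[OF R] half_turn_inverse_powers[OF R]
    half_turn_odd_powers[OF R]
  have "((\<lambda>\<theta>. e0) has_integral e0 * pi) {0..pi}"
    using has_integral_const_real[of e0 0 pi] by (simp add: mult.commute)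
  with R' show ?thesis
    unfolding k_def q_def L_def
    by (intro has_integral_add has_integral_mult_right)
qed

text \<open>Multiply the first component by \<open>x\<close>. Then the monomials of even degree in \<open>x\<close> have an integrand
  even in \<open>\<theta>\<close> and feed \<open>A\<close>, \<open>B\<close>, \<open>C\<close>; the others carry a factor \<open>sin \<theta>\<close> and feed \<open>D\<close>, \<open>E\<close>,
  \<open>G\<close>. All even integrals are divisible by \<open>1 - q\<close>.\<close>
lemma half_turn_quad:
  assumes R: "0 < R" "R < 1"
    and X: "\<And>x y. X (x, y) = (quad p00 p10 p01 p20 p11 p02 x y, quad q00 q10 q01 q20 q11 q02 x y)"
  shows "(half_turn_integrand X R has_integral (1 - R^2) * avg_family
      (pi * (3 / 2 * q00 + 9 / 32 * q01 + 27 / 512 * q02 + 9 / 128 * q20))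
      (pi * (3 / 2 * q00 + 9 / 32 * q01 + 9 / 256 * q02 + 9 / 128 * q20 - 9 / 256 * p11))
      (pi * (3 / 8 * p10 + 9 / 256 * p11 - 3 / 16 * q01 - 45 / 512 * q02 - 9 / 64 * q20))
      (3 / 32 * p02 + 3 / 4 * q10 + 9 / 64 * q11)
      (2 * p00 - 3 / 32 * p02 - 9 / 16 * p20 - 3 / 4 * q10)
      (9 / 32 * p20 - 9 / 128 * q11) R) {0..pi}"
proof -
  define k where "k = 1 - R^2"
  define q where "q = sqrt (1 - R^2)"
  define L where "L = ln ((1 + R) / (1 - R))"
  have q: "q > 0" "q^2 = k" using sqrt_1_minus_square(1,2)[of R] R by (simp_all add: q_def k_def)
  \<comment> \<open>the coefficients of \<open>s^2, s, 1, 1 / s, k / s^2, k^2 / s^3\<close> (even part) and, with a factor \<open>w\<close>,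
      of \<open>s, 1, 1 / s, k / s^2, k^3 / s^4\<close> (odd part)\<close>
  let ?e2 = "q00 + 3 / 16 * q01 + 9 / 256 * q02 - 9 / 64 * q20"
  let ?e1 = "9 / 64 * (2 + k) * q20 -
    k * (q00 + 3 / 8 * p10 + 9 / 128 * p11 + 3 / 16 * q01 + 9 / 256 * q02)"
  let ?e0 = "k * (3 / 4 * p10 + 9 / 64 * p11 - 3 / 16 * q01 - 9 / 128 * q02 - 27 / 64 * q20)"
  let ?f1 = "k^2 * (3 / 16 * q01 + 9 / 128 * q02 + 9 / 64 * q20 - 3 / 8 * p10)"
  let ?f2 = "k * (9 / 256 * q02 - 9 / 64 * p11)"
  let ?f3 = "k * (9 / 128 * p11 - 9 / 256 * q02)"
  let ?g1 = "3 / 8 * q10 + 9 / 128 * q11"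
  let ?g0 = "k * (p00 + 3 / 16 * p01 + 9 / 256 * p02 - 9 / 64 * p20 - 3 / 8 * q10 - 9 / 128 * q11)"
  let ?h1 = "k * (9 / 32 * p20 - 9 / 128 * q11)"
  let ?h2 = "k * (9 / 128 * q11 - 3 / 16 * p01 - 9 / 128 * p02 - 9 / 64 * p20)"
  let ?h4 = "9 / 256 * p02"
  note integral = laurent_half_turn[OF R, of ?e2 ?e1 ?e0 ?f1 ?f2 ?f3 ?g1 ?g0 ?h1 ?h2 ?h4,
      folded q_def L_def, folded k_def]
  have pointwise: "half_turn_integrand X R \<theta> =
      ?e2 * (1 - R * cos \<theta>)^2 + ?e1 * (1 - R * cos \<theta>) + ?e0 + ?f1 * (1 / (1 - R * cos \<theta>)) +
      ?f2 * (k / (1 - R * cos \<theta>)^2) + ?f3 * (k^2 / (1 - R * cos \<theta>)^3) +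
      (?g1 * (R * sin \<theta> * (1 - R * cos \<theta>)) + ?g0 * (R * sin \<theta>) +
       ?h1 * (R * sin \<theta> / (1 - R * cos \<theta>)) + ?h2 * (R * sin \<theta> * k / (1 - R * cos \<theta>)^2) +
       ?h4 * (R * sin \<theta> * k^3 / (1 - R * cos \<theta>)^4))" for \<theta>
  proof -
    define s where "s = 1 - R * cos \<theta>"
    define w where "w = R * sin \<theta>"
    define x where "x = circ_x R \<theta>"
    define y where "y = circ_y R \<theta>"
    define z where "z = 1 / s"
    have s: "s > 0" using one_minus_cos_pos[OF R] by (simp add: s_def)
    have inverses: "1 / s = z" "k / s^2 = k * z^2" "k^2 / s^3 = k^2 * z^3" "w / s = w * z"
        "w * k / s^2 = w * k * z^2" "w * k^3 / s^4 = w * k^3 * z^4"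
      by (simp_all add: z_def power_divide)
    have sz: "s * z = 1" using s by (simp add: z_def)
    have w2: "w^2 = 2 * s - k - s^2"
      unfolding w_def s_def k_def power_mult_distrib sin_squared_eq
      by (simp add: power2_eq_square algebra_simps)
    have x: "x = 3 / 8 * w * z" by (simp add: x_def circ_x_def w_def z_def circ_s_def s_def)
    have y: "y = 3 / 16 * (1 - k * z^2)"
      by (simp add: y_def circ_y_def k_def z_def circ_s_def s_def power_divide)
    have x2: "x^2 = 9 / 64 * (2 * z - k * z^2 - 1)"
    proof -
      have "x^2 = 9 / 64 * (w^2 * z^2)" by (simp add: x power_mult_distrib power_divide)
      also have "w^2 * z^2 = 2 * z - k * z^2 - 1" using w2 sz by algebra
      finally show ?thesis .
    qed
    \<comment> \<open>each product of \<open>x\<close> and \<open>y\<close> is reduced with \<open>s z = 1\<close> and the formula for \<open>w^2\<close>\<close>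
    have kx: "8 / 3 * k * s * x = k * w"
      using sz unfolding x by (simp add: mult.assoc[symmetric])
    have kxx: "k * w * x = 3 / 8 * k * (2 - k * z - s)"
    proof -
      have "k * w * x = 3 / 8 * k * (w^2 * z)" by (simp add: x power2_eq_square)
      also have "w^2 * z = 2 - k * z - s" using w2 sz by algebra
      finally show ?thesis .
    qed
    have sx: "s * (s - k) * x = 3 / 8 * w * (s - k)"
    proof -
      have "s * (s - k) * x = 3 / 8 * w * (s - k) * (s * z)" by (simp add: x)
      then show ?thesis by (simp add: sz)
    qed
    have "half_turn_integrand X R \<theta> = k * w * quad p00 p10 p01 p20 p11 p02 x y +
        s * (s - k) * quad q00 q10 q01 q20 q11 q02 x y"
      unfolding half_turn_integrand_def Let_def X kx[symmetric]
      by (simp add: x_def y_def k_def s_def circ_s_def)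
    also have "k * w * quad p00 p10 p01 p20 p11 p02 x y =
        p00 * (k * w) + p10 * (3 / 8 * k * (2 - k * z - s)) + p01 * (3 / 16 * (k * w - k^2 * w * z^2)) +
        p20 * (9 / 64 * (2 * k * w * z - k^2 * w * z^2 - k * w)) +
        p11 * (9 / 128 * k * (2 - s - 2 * k * z^2 + k^2 * z^3)) +
        p02 * (9 / 256 * (k * w - 2 * k^2 * w * z^2 + k^3 * w * z^4))"
    proof -
      have "k * w * quad p00 p10 p01 p20 p11 p02 x y =
          p00 * (k * w) + p10 * (k * w * x) + p01 * (k * w * y) + p20 * (k * w * x^2) +
          p11 * (k * w * x * y) + p02 * (k * w * y^2)"
        unfolding quad_def by algebra
      moreover have "k * w * y = 3 / 16 * (k * w - k^2 * w * z^2)"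
        unfolding y by algebra
      moreover have "k * w * x^2 = 9 / 64 * (2 * k * w * z - k^2 * w * z^2 - k * w)"
        unfolding x2 by algebra
      moreover have "k * w * x * y = 9 / 128 * k * (2 - s - 2 * k * z^2 + k^2 * z^3)"
        unfolding kxx y using sz by algebra
      moreover have "k * w * y^2 = 9 / 256 * (k * w - 2 * k^2 * w * z^2 + k^3 * w * z^4)"
        unfolding y by algebra
      ultimately show ?thesis by (simp only: kxx)
    qed
    also have "s * (s - k) * quad q00 q10 q01 q20 q11 q02 x y =
        q00 * (s^2 - k * s) + q10 * (3 / 8 * (w * s - k * w)) + q01 * (3 / 16 * (s^2 - k * s - k + k^2 * z)) +
        q20 * (9 / 64 * ((2 + k) * s - s^2 - 3 * k + k^2 * z)) +
        q11 * (9 / 128 * (w * s - k * w - k * w * z + k^2 * w * z^2)) +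
        q02 * (9 / 256 * (s^2 - k * s - 2 * k + 2 * k^2 * z + k^2 * z^2 - k^3 * z^3))"
    proof -
      have "s * (s - k) * quad q00 q10 q01 q20 q11 q02 x y =
          q00 * (s * (s - k)) + q10 * (s * (s - k) * x) + q01 * (s * (s - k) * y) +
          q20 * (s * (s - k) * x^2) + q11 * (s * (s - k) * x * y) + q02 * (s * (s - k) * y^2)"
        unfolding quad_def by algebra
      moreover have "s * (s - k) = s^2 - k * s" by algebra
      moreover have "s * (s - k) * x = 3 / 8 * (w * s - k * w)" unfolding sx by algebra
      moreover have "s * (s - k) * y = 3 / 16 * (s^2 - k * s - k + k^2 * z)"
        unfolding y using sz by algebra
      moreover have "s * (s - k) * x^2 = 9 / 64 * ((2 + k) * s - s^2 - 3 * k + k^2 * z)"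
        unfolding x2 using sz by algebra
      moreover have "s * (s - k) * x * y = 9 / 128 * (w * s - k * w - k * w * z + k^2 * w * z^2)"
        unfolding sx y using sz by algebra
      moreover have "s * (s - k) * y^2 =
          9 / 256 * (s^2 - k * s - 2 * k + 2 * k^2 * z + k^2 * z^2 - k^3 * z^3)"
        unfolding y using sz by algebra
      ultimately show ?thesis by metis
    qed
    finally show ?thesis
      unfolding s_def[symmetric] w_def[symmetric] inverses by algebra
  qed
  have total: "?e2 * (pi * (3 - k) / 2) + ?e1 * pi + ?e0 * pi + ?f1 * (pi / q) + ?f2 * (pi / q) +
      ?f3 * (pi * (3 - k) / (2 * q)) + (?g1 * (2 * R) + ?g0 * (2 * R) + ?h1 * L + ?h2 * (2 * R) +
      ?h4 * (2 * R * (4 - k) / 3)) = (1 - R^2) * avg_family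
      (pi * (3 / 2 * q00 + 9 / 32 * q01 + 27 / 512 * q02 + 9 / 128 * q20))
      (pi * (3 / 2 * q00 + 9 / 32 * q01 + 9 / 256 * q02 + 9 / 128 * q20 - 9 / 256 * p11))
      (pi * (3 / 8 * p10 + 9 / 256 * p11 - 3 / 16 * q01 - 45 / 512 * q02 - 9 / 64 * q20))
      (3 / 32 * p02 + 3 / 4 * q10 + 9 / 64 * q11)
      (2 * p00 - 3 / 32 * p02 - 9 / 16 * p20 - 3 / 4 * q10)
      (9 / 32 * p20 - 9 / 128 * q11) R"
  proof -
    have negative: "?f1 * (pi / q) = q^3 * (3 / 16 * q01 + 9 / 128 * q02 + 9 / 64 * q20 - 3 / 8 * p10) * pi"
      "?f2 * (pi / q) = q * (9 / 256 * q02 - 9 / 64 * p11) * pi"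
      "?f3 * (pi * (3 - k) / (2 * q)) = q * (9 / 128 * p11 - 9 / 256 * q02) * pi * (3 - q^2) / 2"
      using q(1) unfolding q(2)[symmetric] by (simp_all add: divide_simps eval_nat_numeral)
    have family: "(1 - R^2) * avg_family A B C D E G R =
        (1 - q) * (A + B * q + C * q^2) + R * (D + E * q^2) + G * (q^2 * L)" for A B C D E G
    proof -
      have "ln (1 + R) - ln (1 - R) = L" using R by (simp add: L_def ln_div)
      then show ?thesis
        unfolding avg_family_def Let_def q_def[symmetric] k_def[symmetric] q(2)[symmetric]
        using q(1) by (simp add: field_simps power2_eq_square)
    qed
    show ?thesis unfolding negative family unfolding q(2)[symmetric] by algebra
  qed
  show ?thesis
    by (rule has_integral_eq_rhs[OF _ total[symmetric]], rule has_integral_eq[OF _ integral],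
        rule pointwise[symmetric])
qed

lemma half_turn_quadratic_field:
  assumes "quadratic_field X"
  shows "\<exists>A B C D E G. \<forall>R. 0 < R \<longrightarrow> R < 1 \<longrightarrow>
    (half_turn_integrand X R has_integral (1 - R^2) * avg_family A B C D E G R) {0..pi}"
proof -
  obtain p00 p10 p01 p20 p11 p02 where p: "fst (X (x, y)) = quad p00 p10 p01 p20 p11 p02 x y" for x y
    using assms unfolding quadratic_field_def poly2_deg_le_2_iff by blast
  obtain q00 q10 q01 q20 q11 q02 where q: "snd (X (x, y)) = quad q00 q10 q01 q20 q11 q02 x y" for x y
    using assms unfolding quadratic_field_def poly2_deg_le_2_iff by blast
  have "X (x, y) = (quad p00 p10 p01 p20 p11 p02 x y, quad q00 q10 q01 q20 q11 q02 x y)" for x y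
    using p q by (simp add: prod_eq_iff)
  from half_turn_quad[OF _ _ this] show ?thesis by blast
qed

lemma quadratic_field_mirror:
  assumes "quadratic_field X"
  shows "quadratic_field (mirror X)"
proof -
  obtain p00 p10 p01 p20 p11 p02 where p: "fst (X (x, y)) = quad p00 p10 p01 p20 p11 p02 x y" for x y
    using assms unfolding quadratic_field_def poly2_deg_le_2_iff by blast
  obtain q00 q10 q01 q20 q11 q02 where q: "snd (X (x, y)) = quad q00 q10 q01 q20 q11 q02 x y" for x y
    using assms unfolding quadratic_field_def poly2_deg_le_2_iff by blast
  have "fst (mirror X (x, y)) = quad (- p00) p10 (- p01) (- p20) p11 (- p02) x y"
    and "snd (mirror X (x, y)) = quad q00 (- q10) q01 q20 (- q11) q02 x y" for x y
    by (simp_all add: mirror_def p q quad_def)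
  then show ?thesis unfolding quadratic_field_def poly2_deg_le_2_iff by blast
qed

lemma averaged1_in_avg_family:
  assumes "quadratic_field X1p" "quadratic_field X1m"
  shows "\<exists>A B C D E G. \<forall>r. 0 < r \<longrightarrow> r < 1 / 8 \<longrightarrow>
    averaged1 (Z3 X1p X2p X1m X2m) r = (1 - (8 * r)^2) / (24 * r) * avg_family A B C D E G (8 * r)"
proof -
  obtain A B C D E G where plus: "\<forall>R. 0 < R \<longrightarrow> R < 1 \<longrightarrow>
      (half_turn_integrand X1p R has_integral (1 - R^2) * avg_family A B C D E G R) {0..pi}"
    using half_turn_quadratic_field[OF assms(1)] by blast
  obtain A' B' C' D' E' G' where minus: "\<forall>R. 0 < R \<longrightarrow> R < 1 \<longrightarrow>
      (half_turn_integrand (mirror X1m) R has_integral (1 - R^2) * avg_family A' B' C' D' E' G' R) {0..pi}"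
    using half_turn_quadratic_field[OF quadratic_field_mirror[OF assms(2)]] by blast
  have "averaged1 (Z3 X1p X2p X1m X2m) r = (1 - (8 * r)^2) / (24 * r) *
      avg_family (A + A') (B + B') (C + C') (D + D') (E + E') (G + G') (8 * r)"
    if r: "0 < r" "r < 1 / 8" for r
  proof -
    have R: "0 < 8 * r" "8 * r < 1" using r by simp_all
    show ?thesis
      unfolding averaged1_half_turns[OF r plus[rule_format, OF R] minus[rule_format, OF R]]
      by (simp only: avg_family_add distrib_left add_divide_distrib times_divide_eq_left)
  qed
  then show ?thesis by blast
qed

text \<open>A perturbation of one half-plane alone suffices. The witness solves the triangular system
  that \<open>half_turn_quad\<close> gives when only the coefficients of \<open>1, x, x^2, x y\<close> in the first component and of
  \<open>1, x\<close> in the second are used.\<close>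
lemma avg_family_realised:
  "\<exists>X. quadratic_field X \<and> (\<forall>r. 0 < r \<longrightarrow> r < 1 / 8 \<longrightarrow>
    averaged1 (Z3 X (\<lambda>_. 0) (\<lambda>_. 0) (\<lambda>_. 0)) r =
      (1 - (8 * r)^2) / (24 * r) * avg_family A B C D E G (8 * r))"
proof -
  let ?p20 = "32 / 9 * G" and ?q10 = "4 / 3 * D"
  let ?p00 = "(E + D) / 2 + G"
  let ?q00 = "2 / 3 * A / pi" and ?p11 = "256 / 9 * (A - B) / pi"
  let ?p10 = "8 / 3 * (C + B - A) / pi"
  define X :: plane_field where "X = (\<lambda>(x, y). (quad ?p00 ?p10 0 ?p20 ?p11 0 x y, quad ?q00 ?q10 0 0 0 0 x y))"
  have X: "X (x, y) = (quad ?p00 ?p10 0 ?p20 ?p11 0 x y, quad ?q00 ?q10 0 0 0 0 x y)" for x y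
    by (simp add: X_def)
  have "quadratic_field X"
    unfolding quadratic_field_def poly2_deg_le_2_iff X fst_conv snd_conv by blast
  moreover have "averaged1 (Z3 X (\<lambda>_. 0) (\<lambda>_. 0) (\<lambda>_. 0)) r =
      (1 - (8 * r)^2) / (24 * r) * avg_family A B C D E G (8 * r)" if r: "0 < r" "r < 1 / 8" for r
  proof -
    have "(half_turn_integrand X (8 * r) has_integral
        (1 - (8 * r)^2) * avg_family A B C D E G (8 * r)) {0..pi}"
      using half_turn_quad[OF _ _ X, of "8 * r"] r by (simp add: field_simps)
    moreover have "half_turn_integrand (mirror (\<lambda>_. 0)) (8 * r) = (\<lambda>_. 0)"
      by (simp add: fun_eq_iff half_turn_integrand_def mirror_def Let_def)
    then have "(half_turn_integrand (mirror (\<lambda>_. 0)) (8 * r) has_integral 0) {0..pi}" by simp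
    ultimately show ?thesis using averaged1_half_turns[OF r] r by fastforce
  qed
  ultimately show ?thesis by blast
qed


section \<open>Counting simple zeros\<close>

text \<open>If all coefficients vanish, then \<open>f\<close> is zero on the whole interval: every point is a zero, but none
  is simple.\<close>
lemma simple_zeros_at_most_5:
  assumes f: "\<And>r. 0 < r \<Longrightarrow> r < 1 / 8 \<Longrightarrow>
    f r = (1 - (8 * r)^2) / (24 * r) * avg_family A B C D E G (8 * r)"
  shows "finite (simple_zeros f {0<..<1/8}) \<and> card (simple_zeros f {0<..<1/8}) \<le> 5"
proof (cases "A = 0 \<and> B = 0 \<and> C = 0 \<and> D = 0 \<and> E = 0 \<and> G = 0")
  case True
  have "D' = 0" if "\<rho> \<in> {0<..<1/8}" "(f has_real_derivative D') (at \<rho>)" for \<rho> D'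
  proof -
    have "((\<lambda>_. 0) has_real_derivative D') (at \<rho>)"
    proof (rule has_field_derivative_transform_within_open[OF that(2) _ that(1)])
      show "f r = 0" if "r \<in> {0<..<1/8}" for r
        using that f[of r] True by (simp add: avg_family_def Let_def)
    qed simp
    then show ?thesis using DERIV_unique[OF _ DERIV_const] by blast
  qed
  then have "simple_zeros f {0<..<1/8} = {}" unfolding simple_zeros_def by blast
  then show ?thesis by simp
next
  case False
  then have bound: "at_most_zeros 5 (avg_family A B C D E G) {0<..<1}"
    by (intro avg_family_at_most_5_zeros) blast
  let ?S = "simple_zeros f {0<..<1/8}"
  have sub: "(*) 8 ` ?S \<subseteq> {R \<in> {0<..<1}. avg_family A B C D E G R = 0}"
  proof (intro image_subsetI)
    fix r assume "r \<in> ?S"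
    then have r: "0 < r" "r < 1 / 8" "f r = 0" by (auto simp: simple_zeros_def)
    then have "\<bar>8 * r\<bar> < 1" by simp
    then have "(8 * r)^2 < 1" by (simp only: abs_square_less_1)
    then show "8 * r \<in> {R \<in> {0<..<1}. avg_family A B C D E G R = 0}"
      using f[OF r(1,2)] r by simp
  qed
  have inj: "inj_on ((*) 8) ?S" by (simp add: inj_on_def)
  have "finite ((*) 8 ` ?S)"
    using finite_subset[OF sub] bound unfolding at_most_zeros_def by blast
  then have "finite ?S" using inj finite_imageD by blast
  moreover have "card ?S \<le> 5"
    using at_most_zeros_card_le[OF bound sub] by (simp add: card_image[OF inj])
  ultimately show ?thesis by blast
qed

text \<open>Five zeros are the maximum allowed by \<open>avg_family_zeros_interlace\<close>, which leaves no room for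
  the derivative to vanish at any of them.\<close>
lemma five_simple_zeros:
  obtains A B C D E G where "\<And>f. (\<And>r. 0 < r \<Longrightarrow> r < 1 / 8 \<Longrightarrow>
      f r = (1 - (8 * r)^2) / (24 * r) * avg_family A B C D E G (8 * r)) \<Longrightarrow>
    card (simple_zeros f {0<..<1/8}) = 5"
proof -
  obtain A B C D E G where nontrivial: "A \<noteq> 0 \<or> B \<noteq> 0 \<or> C \<noteq> 0 \<or> D \<noteq> 0 \<or> E \<noteq> 0 \<or> G \<noteq> 0"
    and zeros: "\<forall>R \<in> {1/6, 2/6, 3/6, 4/6, 5/6}. avg_family A B C D E G R = 0"
    using avg_family_interpolation[of "1/6" "2/6" "3/6" "4/6" "5/6"] by blast
  let ?\<Phi> = "avg_family A B C D E G" and ?\<Phi>' = "avg_family_deriv A B C D E G"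
  define Z where "Z = {1/6, 2/6, 3/6, 4/6, 5/6 :: real}"
  have Z: "finite Z" "card Z = 5" "Z \<subseteq> {R \<in> {0<..<1}. ?\<Phi> R = 0}"
    using zeros unfolding Z_def by auto
  have "card {R \<in> Z. ?\<Phi>' R = 0} = 0"
    using avg_family_zeros_interlace[OF nontrivial Z(1,3)] Z(2) by linarith
  then have Z_simple: "?\<Phi>' R \<noteq> 0" if "R \<in> Z" for R
    using that Z(1) by (simp add: card_eq_0_iff)
  have "card (simple_zeros f {0<..<1/8}) = 5"
    if f: "\<And>r. 0 < r \<Longrightarrow> r < 1 / 8 \<Longrightarrow>
      f r = (1 - (8 * r)^2) / (24 * r) * ?\<Phi> (8 * r)" for f
  proof -
    let ?S = "simple_zeros f {0<..<1/8}"
    have "(\<lambda>R. R / 8) ` Z \<subseteq> ?S"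
    proof (intro image_subsetI)
      fix R assume "R \<in> Z"
      then have R: "0 < R" "R < 1" "?\<Phi> R = 0" using Z(3) by auto
      define g where "g = (\<lambda>r :: real. (1 - (8 * r)^2) / (24 * r))"
      let ?g' = "(- 128 * (R / 8) * (24 * (R / 8)) - (1 - R^2) * 24) / (24 * (R / 8))^2"
      have g: "(g has_real_derivative ?g') (at (R / 8))"
        unfolding g_def using R(1)
        by (auto intro!: derivative_eq_intros simp: power2_eq_square)
      have "(?\<Phi> has_real_derivative ?\<Phi>' R) (at (8 * (R / 8)))"
        using avg_family_has_derivative[of R A B C D E G] R by simp
      moreover have "((\<lambda>r. 8 * r) has_real_derivative 8) (at (R / 8))"
        by (auto intro!: derivative_eq_intros)
      ultimately have \<Phi>: "((\<lambda>r. ?\<Phi> (8 * r)) has_real_derivative ?\<Phi>' R * 8) (at (R / 8))"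
        by (rule DERIV_chain2)
      from DERIV_mult[OF g \<Phi>]
      have "((\<lambda>r. g r * ?\<Phi> (8 * r)) has_real_derivative 8 * ?\<Phi>' R * g (R / 8)) (at (R / 8))"
        using R(3) by (simp add: mult_ac)
      then have "(f has_real_derivative 8 * ?\<Phi>' R * g (R / 8)) (at (R / 8))"
      proof (rule has_field_derivative_transform_within_open)
        show "open {0<..<1/8::real}" by simp
        show "R / 8 \<in> {0<..<1/8}" using R by simp
        show "g r * ?\<Phi> (8 * r) = f r" if "r \<in> {0<..<1/8}" for r
          using that f[of r] by (simp add: g_def)
      qed
      moreover have "R^2 < 1" using R by (simp add: abs_square_less_1)
      then have "g (R / 8) \<noteq> 0" using R by (simp add: g_def power_divide)
      then have "8 * ?\<Phi>' R * g (R / 8) \<noteq> 0" using Z_simple[OF \<open>R \<in> Z\<close>] by simp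
      moreover have "f (R / 8) = 0" using f[of "R / 8"] R by simp
      ultimately show "R / 8 \<in> ?S" unfolding simple_zeros_def using R by auto
    qed
    moreover have "card ((\<lambda>R. R / 8) ` Z) = 5"
      using Z(2) by (simp add: card_image inj_on_def)
    moreover have "finite ?S" "card ?S \<le> 5"
      using simple_zeros_at_most_5[of f A B C D E G] f by blast+
    ultimately show ?thesis using card_mono[of ?S "(\<lambda>R. R / 8) ` Z"] by linarith
  qed
  then show ?thesis by (rule that)
qed

theorem proposition3p2:
  shows "(\<forall>X1p X2p X1m X2m.
            quadratic_field X1p \<and> quadratic_field X2p \<and>
            quadratic_field X1m \<and> quadratic_field X2m \<longrightarrow>
            finite (simple_zeros (averaged1 (Z3 X1p X2p X1m X2m)) {0<..<1/8}) \<and>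
            card (simple_zeros (averaged1 (Z3 X1p X2p X1m X2m)) {0<..<1/8}) \<le> 5) \<and>
         (\<exists>X1p X2p X1m X2m.
            quadratic_field X1p \<and> quadratic_field X2p \<and>
            quadratic_field X1m \<and> quadratic_field X2m \<and>
            finite (simple_zeros (averaged1 (Z3 X1p X2p X1m X2m)) {0<..<1/8}) \<and>
            card (simple_zeros (averaged1 (Z3 X1p X2p X1m X2m)) {0<..<1/8}) = 5)"
proof (rule conjI, intro allI impI)
  fix X1p X2p X1m X2m
  assume "quadratic_field X1p \<and> quadratic_field X2p \<and> quadratic_field X1m \<and> quadratic_field X2m"
  then obtain A B C D E G where "\<And>r. 0 < r \<Longrightarrow> r < 1 / 8 \<Longrightarrow>
      averaged1 (Z3 X1p X2p X1m X2m) r = (1 - (8 * r)^2) / (24 * r) * avg_family A B C D E G (8 * r)"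
    using averaged1_in_avg_family[of X1p X1m X2p X2m] by blast
  then show "finite (simple_zeros (averaged1 (Z3 X1p X2p X1m X2m)) {0<..<1/8}) \<and>
      card (simple_zeros (averaged1 (Z3 X1p X2p X1m X2m)) {0<..<1/8}) \<le> 5"
    by (rule simple_zeros_at_most_5)
next
  obtain A B C D E G where five: "\<And>f. (\<And>r. 0 < r \<Longrightarrow> r < 1 / 8 \<Longrightarrow>
      f r = (1 - (8 * r)^2) / (24 * r) * avg_family A B C D E G (8 * r)) \<Longrightarrow>
    card (simple_zeros f {0<..<1/8}) = 5"
    using five_simple_zeros by blast
  obtain X where X: "quadratic_field X" "\<And>r. 0 < r \<Longrightarrow> r < 1 / 8 \<Longrightarrow>
      averaged1 (Z3 X (\<lambda>_. 0) (\<lambda>_. 0) (\<lambda>_. 0)) r =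
        (1 - (8 * r)^2) / (24 * r) * avg_family A B C D E G (8 * r)"
    using avg_family_realised[of A B C D E G] by blast
  have zero: "quadratic_field (\<lambda>_. 0)"
    unfolding quadratic_field_def poly2_deg_le_def by (auto intro!: exI[of _ "\<lambda>_ _. 0"])
  have "card (simple_zeros (averaged1 (Z3 X (\<lambda>_. 0) (\<lambda>_. 0) (\<lambda>_. 0))) {0<..<1/8}) = 5"
    using X(2) by (rule five)
  moreover from this have "finite (simple_zeros (averaged1 (Z3 X (\<lambda>_. 0) (\<lambda>_. 0) (\<lambda>_. 0))) {0<..<1/8})"
    by (intro card_ge_0_finite) simp
  ultimately show "\<exists>X1p X2p X1m X2m.
            quadratic_field X1p \<and> quadratic_field X2p \<and>
            quadratic_field X1m \<and> quadratic_field X2m \<and>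
            finite (simple_zeros (averaged1 (Z3 X1p X2p X1m X2m)) {0<..<1/8}) \<and>
            card (simple_zeros (averaged1 (Z3 X1p X2p X1m X2m)) {0<..<1/8}) = 5"
    using X(1) zero by blast
qed

end
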